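(* Let $m\ge 1$, let $X\in\{\mathbb{RP}^m,\mathbb{CP}^m,\mathbb{HP}^m\}$, let $\pi:S^{m(X)}\to X$ be the usual Riemannian submersion, let $\lambda,\mu\in\mathbb{C}$, and let $\mathcal F$ be a family of functions $X\to\mathbb{C}$. The following are equivalent: (i) $\mathcal F$ is a $(\lambda,\mu)$-eigenfamily on $X$. (ii) $\pi^*(\mathcal F)=\{F\circ\pi:S^{m(X)}\to\mathbb{C}\mid F\in\mathcal F\}$ is a $(\lambda,\mu)$-eigenfamily on $S^{m(X)}$.
   Context: For a Riemannian manifold $(M,g)$, $\Delta=\operatorname{div}\nabla$ is the Laplace–Beltrami operator, extended complex linearly to $\mathbb{C}$-valued functions. For smooth $\varphi:M\to\mathbb{C}$, $\nabla\varphi=\nabla\operatorname{Re}\varphi+i\nabla\operatorname{Im}\varphi$ is a section of $TM\otimes\mathbb{C}$, and $g_{\mathbb{C}}$ is the complex bilinear extension of $g$ to $TM\otimes\mathbb{C}$. A family (set) $\mathcal F$ of smooth functions $M\to\mathbb{C}$ is a $(\lambda,\mu)$-eigenfamily on $M$ if for all $\varphi,\psi\in\mathcal F$: $\Delta\varphi=\lambda\varphi$ and $g_{\mathbb{C}}(\nabla\varphi,\nabla\psi)=\mu\,\varphi\psi$. Here $m(\mathbb{RP}^m)=m$, $m(\mathbb{CP}^m)=2m+1$, $m(\mathbb{HP}^m)=4m+3$; $S^{m(X)}$ is the round unit sphere in $\mathbb{R}^{m+1}$, $\mathbb{C}^{m+1}$, $\mathbb{H}^{m+1}$ respectively; $\pi$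 is the quotient map by the standard action of $S^0=\{\pm1\}$, $S^1=U(1)$, $S^3=SU(2)$ (unit scalars) respectively, and $X$ carries the metric making $\pi$ a Riemannian submersion (whose fibres are totally geodesic). *)

theory Defs
  imports "HOL-Analysis.Analysis"
begin

section \<open>Quaternions\<close>

datatype quat = Quat (qre: real) (qi: real) (qj: real) (qk: real)

lemma quat_eq_iff: "x = y \<longleftrightarrow> qre x = qre y \<and> qi x = qi y \<and> qj x = qj y \<and> qk x = qk y"
  by (cases x; cases y) auto

instantiation quat :: ab_group_add
begin
definition "0 = Quat 0 0 0 0"
definition "x + y = Quat (qre x + qre y) (qi x + qi y) (qj x + qj y) (qk x + qk y)"
definition "- x = Quat (- qre x) (- qi x) (- qj x) (- qk x)"
definition "x - y = Quat (qre x - qre y) (qi x - qi y) (qj x - qj y) (qk x - qk y)"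
instance
  by standard (auto simp: zero_quat_def plus_quat_def uminus_quat_def minus_quat_def)
end

lemma quat_sel_add [simp]:
  "qre 0 = 0" "qi 0 = 0" "qj 0 = 0" "qk 0 = 0"
  "qre (x + y) = qre x + qre y" "qi (x + y) = qi x + qi y"
  "qj (x + y) = qj x + qj y" "qk (x + y) = qk x + qk y"
  "qre (- x) = - qre x" "qi (- x) = - qi x" "qj (- x) = - qj x" "qk (- x) = - qk x"
  "qre (x - y) = qre x - qre y" "qi (x - y) = qi x - qi y"
  "qj (x - y) = qj x - qj y" "qk (x - y) = qk x - qk y"
  by (simp_all add: zero_quat_def plus_quat_def uminus_quat_def minus_quat_def)

instantiation quat :: real_algebra_1
begin
definition "1 = Quat 1 0 0 0"
definition "x * y = Quat
  (qre x * qre y - qi x * qi y - qj x * qj y - qk x * qk y)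
  (qre x * qi y + qi x * qre y + qj x * qk y - qk x * qj y)
  (qre x * qj y - qi x * qk y + qj x * qre y + qk x * qi y)
  (qre x * qk y + qi x * qj y - qj x * qi y + qk x * qre y)"
definition "a *\<^sub>R x = Quat (a * qre x) (a * qi x) (a * qj x) (a * qk x)"
instance
  by standard
    (auto simp: quat_eq_iff one_quat_def times_quat_def scaleR_quat_def algebra_simps)
end

lemma quat_sel_mult [simp]:
  "qre 1 = 1" "qi 1 = 0" "qj 1 = 0" "qk 1 = 0"
  "qre (a *\<^sub>R x) = a * qre x" "qi (a *\<^sub>R x) = a * qi x"
  "qj (a *\<^sub>R x) = a * qj x" "qk (a *\<^sub>R x) = a * qk x"
  "qre (x * y) = qre x * qre y - qi x * qi y - qj x * qj y - qk x * qk y"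
  "qi (x * y) = qre x * qi y + qi x * qre y + qj x * qk y - qk x * qj y"
  "qj (x * y) = qre x * qj y - qi x * qk y + qj x * qre y + qk x * qi y"
  "qk (x * y) = qre x * qk y + qi x * qj y - qj x * qi y + qk x * qre y"
  by (simp_all add: one_quat_def times_quat_def scaleR_quat_def)

instantiation quat :: real_inner
begin
definition "inner x y = qre x * qre y + qi x * qi y + qj x * qj y + qk x * qk y"
definition "norm (x::quat) = sqrt (inner x x)"
definition "sgn (x::quat) = x /\<^sub>R norm x"
definition "dist (x::quat) y = norm (x - y)"
definition
  "(uniformity :: (quat \<times> quat) filter) = (INF e\<in>{0 <..}. principal {(x, y). dist x y < e})"
definition
  "open (U :: quat set) \<longleftrightarrow> (\<forall>x\<in>U. eventually (\<lambda>(x', y). x' = x \<longrightarrow> y \<in> U) uniformity)"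
instance
proof
  fix x y z :: quat and r :: real and U :: "quat set"
  have nn: "0 \<le> inner x x"
    by (simp add: inner_quat_def)
  then show "0 \<le> inner x x" .
  show "inner x x = 0 \<longleftrightarrow> x = 0"
    by (simp add: inner_quat_def quat_eq_iff add_nonneg_eq_0_iff)
  show "inner x y = inner y x" "inner (x + y) z = inner x z + inner y z"
    "inner (r *\<^sub>R x) y = r * inner x y"
    by (simp_all add: inner_quat_def algebra_simps)
qed (fact norm_quat_def sgn_quat_def dist_quat_def uniformity_quat_def open_quat_def)+
end

instantiation quat :: real_normed_div_algebra
begin
definition "inverse x = Quat (qre x) (- qi x) (- qj x) (- qk x) /\<^sub>R (norm x)\<^sup>2"
definition "x div (y::quat) = x * inverse y"
instance
proof
  fix x y :: quat
  have n2: "(norm x)\<^sup>2 = qre x * qre x + qi x * qi x + qj x * qj x + qk x * qk x" for x :: quat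
    by (simp add: power2_norm_eq_inner inner_quat_def)
  have ne: "(norm x)\<^sup>2 \<noteq> 0" if "x \<noteq> 0"
    using that by simp
  define c where "c = Quat (qre x) (- qi x) (- qj x) (- qk x)"
  have c: "c * x = (norm x)\<^sup>2 *\<^sub>R 1" "x * c = (norm x)\<^sup>2 *\<^sub>R 1"
    by (simp_all add: quat_eq_iff c_def n2)
  have inv: "inverse x = c /\<^sub>R (norm x)\<^sup>2"
    by (simp add: inverse_quat_def c_def)
  show "inverse x * x = 1" if "x \<noteq> 0"
    using ne[OF that] c by (simp add: inv)
  show "x * inverse x = 1" if "x \<noteq> 0"
    using ne[OF that] c by (simp add: inv)
  show "x div y = x * inverse y"
    by (simp add: divide_quat_def)
  show "inverse (0::quat) = 0"
    by (simp add: inverse_quat_def quat_eq_iff)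
  have "(norm (x * y))\<^sup>2 = (norm x * norm y)\<^sup>2"
    unfolding power_mult_distrib n2 quat_sel_mult by algebra
  then show "norm (x * y) = norm x * norm y"
    by (rule power2_eq_imp_eq) simp_all
qed
end

instantiation quat :: euclidean_space
begin
definition "Basis = {Quat 1 0 0 0, Quat 0 1 0 0, Quat 0 0 1 0, Quat 0 0 0 1}"
instance
proof
  fix u v x :: quat
  show "(Basis :: quat set) \<noteq> {}" "finite (Basis :: quat set)"
    by (simp_all add: Basis_quat_def)
  show "inner u v = (if u = v then 1 else 0)" if "u \<in> Basis" "v \<in> Basis"
    using that unfolding Basis_quat_def by (elim insertE emptyE) (simp_all add: inner_quat_def)
  show "(\<forall>u\<in>Basis. inner x u = 0) \<longleftrightarrow> x = 0"
    by (simp add: Basis_quat_def inner_quat_def quat_eq_iff[of x 0])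
qed
end

lemma DIM_quat [simp]: "DIM(quat) = 4"
  by (simp add: Basis_quat_def)


section \<open>Smooth maps\<close>

text \<open>Both notions are meant for open \<open>S\<close>.\<close>

primrec C_n_on :: "nat \<Rightarrow> 'a::real_normed_vector set \<Rightarrow> ('a \<Rightarrow> 'b::real_normed_vector) \<Rightarrow> bool"
  where
    "C_n_on 0 S f \<longleftrightarrow> continuous_on S f"
  | "C_n_on (Suc n) S f \<longleftrightarrow>
       (\<forall>x\<in>S. f differentiable (at x)) \<and>
       (\<forall>v. C_n_on n S (\<lambda>x. frechet_derivative f (at x) v))"

definition smooth_on :: "'a::real_normed_vector set \<Rightarrow> ('a \<Rightarrow> 'b::real_normed_vector) \<Rightarrow> bool"
  where "smooth_on S f \<longleftrightarrow> (\<forall>n. C_n_on n S f)"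


section \<open>Riemannian manifolds through local parametrizations\<close>

text \<open>
  A Riemannian manifold with points in \<open>'p\<close>, modelled on the Euclidean space \<open>'e\<close>, is given by an
  atlas of local parametrizations \<open>(U, p)\<close>, with \<open>U\<close> open in \<open>'e\<close> and \<open>p\<close> mapping \<open>U\<close> onto an open
  set of points, and by the metric tensor in each of them: \<open>metric M (U, p) x\<close> is the inner product
  on the tangent space at \<open>p x\<close>, which is identified with \<open>'e\<close> by the differential of \<open>p\<close>. The
  underlying set is the union of the sets \<open>p ` U\<close>; functions on the manifold are functions on the
  type \<open>'p\<close> of which only the values on this set matter.
\<close>

type_synonym ('p, 'e) param = "'e set \<times> ('e \<Rightarrow> 'p)"

record ('p, 'e) riemannian =
  params :: "('p, 'e) param set"
  metric :: "('p, 'e) param \<Rightarrow> 'e \<Rightarrow> 'e \<Rightarrow> 'e \<Rightarrow> real"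

text \<open>
  In the next five definitions \<open>g\<close> is the metric tensor in a fixed parametrization.
  \<open>christoffel\<close> is the Koszul formula for constant vector fields; the divergence of a
  vector field \<open>X\<close> is the trace of \<open>v \<mapsto> \<nabla>\<^sub>v X\<close> for the Levi-Civita connection (the inner product
  of \<open>'e\<close> serves only to compute the trace).
\<close>

definition grad :: "('e::euclidean_space \<Rightarrow> 'e \<Rightarrow> 'e \<Rightarrow> real) \<Rightarrow> ('e \<Rightarrow> real) \<Rightarrow> 'e \<Rightarrow> 'e"
  where "grad g f x = (THE v. \<forall>w. g x v w = frechet_derivative f (at x) w)"

definition christoffel :: "('e::euclidean_space \<Rightarrow> 'e \<Rightarrow> 'e \<Rightarrow> real) \<Rightarrow> 'e \<Rightarrow> 'e \<Rightarrow> 'e \<Rightarrow> 'e"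
  where "christoffel g x v w = (THE c. \<forall>u. 2 * g x c u =
      frechet_derivative (\<lambda>y. g y w u) (at x) v
    + frechet_derivative (\<lambda>y. g y v u) (at x) w
    - frechet_derivative (\<lambda>y. g y v w) (at x) u)"

definition cov_deriv ::
    "('e::euclidean_space \<Rightarrow> 'e \<Rightarrow> 'e \<Rightarrow> real) \<Rightarrow> 'e \<Rightarrow> ('e \<Rightarrow> 'e) \<Rightarrow> 'e \<Rightarrow> 'e"
  where "cov_deriv g v X x = frechet_derivative X (at x) v + christoffel g x v (X x)"

definition divergence :: "('e::euclidean_space \<Rightarrow> 'e \<Rightarrow> 'e \<Rightarrow> real) \<Rightarrow> ('e \<Rightarrow> 'e) \<Rightarrow> 'e \<Rightarrow> real"
  where "divergence g X x = (\<Sum>b\<in>Basis. cov_deriv g b X x \<bullet> b)"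

definition laplacian :: "('e::euclidean_space \<Rightarrow> 'e \<Rightarrow> 'e \<Rightarrow> real) \<Rightarrow> ('e \<Rightarrow> real) \<Rightarrow> 'e \<Rightarrow> real"
  where "laplacian g f x = divergence g (grad g f) x"

text \<open>The pair \<open>(v, w)\<close> stands for the complexified tangent vector \<open>v + \<i> w\<close>.\<close>

definition cgrad ::
    "('e::euclidean_space \<Rightarrow> 'e \<Rightarrow> 'e \<Rightarrow> real) \<Rightarrow> ('e \<Rightarrow> complex) \<Rightarrow> 'e \<Rightarrow> 'e \<times> 'e"
  where "cgrad g f x = (grad g (\<lambda>y. Re (f y)) x, grad g (\<lambda>y. Im (f y)) x)"

definition cbilinear :: "('e \<Rightarrow> 'e \<Rightarrow> 'e \<Rightarrow> real) \<Rightarrow> 'e \<Rightarrow> 'e \<times> 'e \<Rightarrow> 'e \<times> 'e \<Rightarrow> complex"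
  where "cbilinear g x v w =
    Complex (g x (fst v) (fst w) - g x (snd v) (snd w))
            (g x (fst v) (snd w) + g x (snd v) (fst w))"

definition claplacian ::
    "('e::euclidean_space \<Rightarrow> 'e \<Rightarrow> 'e \<Rightarrow> real) \<Rightarrow> ('e \<Rightarrow> complex) \<Rightarrow> 'e \<Rightarrow> complex"
  where "claplacian g f x =
    Complex (laplacian g (\<lambda>y. Re (f y)) x) (laplacian g (\<lambda>y. Im (f y)) x)"

definition smooth_fun :: "('p, 'e::euclidean_space) riemannian \<Rightarrow> ('p \<Rightarrow> complex) \<Rightarrow> bool"
  where "smooth_fun M f \<longleftrightarrow> (\<forall>(U, p)\<in>params M. smooth_on U (f \<circ> p))"

definition eigenfamily ::
    "complex \<Rightarrow> complex \<Rightarrow> ('p, 'e::euclidean_space) riemannian \<Rightarrow> ('p \<Rightarrow> complex) set \<Rightarrow> bool"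
  where "eigenfamily l \<mu> M \<F> \<longleftrightarrow>
    (\<forall>\<phi>\<in>\<F>. smooth_fun M \<phi>) \<and>
    (\<forall>\<phi>\<in>\<F>. \<forall>\<psi>\<in>\<F>. \<forall>(U, p)\<in>params M. \<forall>x\<in>U.
       claplacian (metric M (U, p)) (\<phi> \<circ> p) x = l * \<phi> (p x) \<and>
       cbilinear (metric M (U, p)) x
         (cgrad (metric M (U, p)) (\<phi> \<circ> p) x) (cgrad (metric M (U, p)) (\<psi> \<circ> p) x)
         = \<mu> * \<phi> (p x) * \<psi> (p x))"


section \<open>The round unit sphere\<close>

text \<open>
  The dimension of the model \<open>'e\<close> has to be one less than that of \<open>'a\<close>. The atlas is the maximal
  one, of all smooth local parametrizations of the submanifold \<open>sphere 0 1\<close>.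
\<close>

definition round_sphere :: "('a::euclidean_space, 'e::euclidean_space) riemannian"
  where "round_sphere = \<lparr>
    params = {(U, p). open U \<and> smooth_on U p
      \<and> (\<forall>x\<in>U. inj (frechet_derivative p (at x)))
      \<and> openin (top_of_set (sphere 0 1)) (p ` U)
      \<and> homeomorphism U (p ` U) p (inv_into U p)},
    metric = (\<lambda>(U, p) x v w. frechet_derivative p (at x) v \<bullet> frechet_derivative p (at x) w)\<rparr>"


section \<open>Projective spaces\<close>

text \<open>
  The metric that turns a submersion \<open>\<pi>\<close> from \<open>M\<close> into a Riemannian submersion: in the
  parametrization \<open>(V, q)\<close> of the target, the inner product of \<open>\<xi>\<close> and \<open>\<eta>\<close> is the inner product in
  \<open>M\<close> of horizontal vectors \<open>v\<close>, \<open>w\<close>, at an arbitrary point over \<open>q y\<close>, that the differential of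
  \<open>\<pi>\<close> maps to \<open>\<xi>\<close> and \<open>\<eta>\<close>.
\<close>

definition diff_in_params ::
    "('p \<Rightarrow> 'q) \<Rightarrow> ('p, 'e::euclidean_space) param \<Rightarrow> ('q, 'f::euclidean_space) param \<Rightarrow> 'e \<Rightarrow> 'e \<Rightarrow> 'f"
  where "diff_in_params \<pi> c d x =
    frechet_derivative (inv_into (fst d) (snd d) \<circ> \<pi> \<circ> snd c) (at x)"

definition horizontal ::
    "('p, 'e::euclidean_space) riemannian \<Rightarrow> ('p \<Rightarrow> 'q) \<Rightarrow> ('p, 'e) param \<Rightarrow>
     ('q, 'f::euclidean_space) param \<Rightarrow> 'e \<Rightarrow> 'e set"
  where "horizontal M \<pi> c d x =
    {v. \<forall>u. diff_in_params \<pi> c d x u = 0 \<longrightarrow> metric M c x v u = 0}"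

definition submersion_metric ::
    "('p, 'e::euclidean_space) riemannian \<Rightarrow> ('p \<Rightarrow> 'q) \<Rightarrow>
     ('q, 'f::euclidean_space) param \<Rightarrow> 'f \<Rightarrow> 'f \<Rightarrow> 'f \<Rightarrow> real"
  where "submersion_metric M \<pi> d y \<xi> \<eta> = (THE r.
    \<forall>(U, p)\<in>params M. \<forall>x\<in>U. \<pi> (p x) = snd d y \<longrightarrow>
      (\<forall>v\<in>horizontal M \<pi> (U, p) d x. \<forall>w\<in>horizontal M \<pi> (U, p) d x.
         diff_in_params \<pi> (U, p) d x v = \<xi> \<and> diff_in_params \<pi> (U, p) d x w = \<eta> \<longrightarrow>
         metric M (U, p) x v w = r))"

text \<open>
  The scalars \<open>'k\<close> are \<open>real\<close>, \<open>complex\<close> or \<open>quat\<close>, and the \<open>m + 1\<close> homogeneous coordinates are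
  indexed by \<open>'m option\<close>, where \<open>m = CARD('m)\<close>. Unit scalars act from the right. The points of
  the projective space are the orbits in the unit sphere.
\<close>

definition orbit :: "'k::real_normed_div_algebra ^ 'n \<Rightarrow> ('k ^ 'n) set"
  where "orbit z = {(\<chi> i. z $ i * u) | u. norm u = 1}"

text \<open>
  An injection \<open>e\<close> of \<open>'m\<close> into the indices misses exactly one index \<open>i\<close>, and \<open>affine_param e\<close> is
  the inverse of the affine chart \<open>[z] \<mapsto> (z\<^sub>e\<^sub>(\<^sub>j\<^sub>) z\<^sub>i\<^sup>-\<^sup>1)\<^sub>j\<close> on the set where \<open>z\<^sub>i \<noteq> 0\<close>.
\<close>

definition homogenize ::
    "('m \<Rightarrow> 'm option) \<Rightarrow> 'k::real_normed_div_algebra ^ 'm::finite \<Rightarrow> 'k ^ 'm option"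
  where "homogenize e w = (\<chi> i. if i \<in> range e then w $ inv e i else 1)"

definition affine_param ::
    "('m \<Rightarrow> 'm option) \<Rightarrow> 'k::real_normed_div_algebra ^ 'm::finite \<Rightarrow> ('k ^ 'm option) set"
  where "affine_param e w = orbit (homogenize e w /\<^sub>R norm (homogenize e w))"

text \<open>The argument is the round sphere, with its model space.\<close>

definition projective_space ::
    "('k::{real_normed_div_algebra, euclidean_space} ^ 'm option, 'e::euclidean_space) riemannian \<Rightarrow>
     (('k ^ 'm::finite option) set, 'k ^ 'm) riemannian"
  where "projective_space S = \<lparr>
    params = {(UNIV, affine_param e) | e. inj e},
    metric = submersion_metric S orbit\<rparr>"

text \<open>
  The spheres of dimension \<open>m\<close>, \<open>2 m + 1\<close> and \<open>4 m + 3\<close>. In the model spaces, \<open>+\<close> is the sum of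
  types and the numerals are the types with that many elements.
\<close>

abbreviation sphere_R :: "(real ^ 'm::finite option, real ^ 'm) riemannian"
  where "sphere_R \<equiv> round_sphere"

abbreviation sphere_C :: "(complex ^ 'm::finite option, real ^ ('m + 'm + 1)) riemannian"
  where "sphere_C \<equiv> round_sphere"

abbreviation sphere_H :: "(quat ^ 'm::finite option, real ^ ('m + 'm + 'm + 'm + 3)) riemannian"
  where "sphere_H \<equiv> round_sphere"

definition RP :: "((real ^ 'm::finite option) set, real ^ 'm) riemannian"
  where "RP = projective_space sphere_R"

definition CP :: "((complex ^ 'm::finite option) set, complex ^ 'm) riemannian"
  where "CP = projective_space sphere_C"

definition HP :: "((quat ^ 'm::finite option) set, quat ^ 'm) riemannian"
  where "HP = projective_space sphere_H"

definition pullback :: "('p \<Rightarrow> 'q) \<Rightarrow> ('q \<Rightarrow> complex) set \<Rightarrow> ('p \<Rightarrow> complex) set"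
  where "pullback \<pi> \<F> = {F \<circ> \<pi> | F. F \<in> \<F>}"

end

theory Submission
  imports Defs
begin

text \<open>
  In an affine chart the submersion metric is the Fubini--Study metric, and a function on the sphere
  pulled back from the projective space is \<open>\<phi> \<circ> \<sigma>\<close> with \<open>\<sigma> z = (z\<^sub>e\<^sub>(\<^sub>j\<^sub>) z\<^sub>i\<^sup>-\<^sup>1)\<^sub>j\<close>. Its
  gradient and Laplacian are computed in an orthonormal frame of the sphere made of horizontal lifts
  and of vertical vectors \<open>z c\<close> with \<open>c\<close> imaginary. As \<open>\<sigma>\<close> is constant on scalar multiples, its first
  and second derivatives vanish on the vertical vectors. On the horizontal lift of \<open>v\<close> the second
  derivative of \<open>\<sigma>\<close> is \<open>- \<Gamma>(v, v)\<close> for the Fubini--Study connection. Hence both operators commute with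
  the pullback. The computation uses nothing about the scalars but that their norm is multiplicative
  and Euclidean, so it covers the three cases at once.
\<close>


section \<open>Smooth maps\<close>

text \<open>The sphere is curved in its ambient space, so the ambient Hessian of a function and its
  Hessian on the sphere differ by a normal term. That term vanishes here because
  \<open>\<phi> \<circ> \<sigma>\<close> is constant on rays: its ambient gradient is already
  tangent to the sphere. Hence the Laplacian of the pullback is the trace of the ambient Hessian
  over a tangent frame, and the second derivatives of a parametrization cancel against its
  Christoffel terms. The operators are given through \<open>THE\<close> and
  \<open>frechet_derivative\<close>, which say something only once existence is known. So linear
  forms have to be represented and the gradient has to be shown differentiable; for the latter it is
  regarded as the solution of a linear system with differentiable coefficients. The submersion
  metric is well defined because every horizontal vector is a lift whose length is the same at all
  points of the fibre. Smoothness does not descend from the sphere by itself: it is carried down by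
  composing with a smooth section of \<open>orbit\<close> over each chart.\<close>

lemma linear_Basis_expansion:
  fixes L :: "'a::euclidean_space \<Rightarrow> 'b::real_vector"
  assumes "linear L"
  shows "L v = (\<Sum>b\<in>Basis. (v \<bullet> b) *\<^sub>R L b)"
proof -
  have "L v = L (\<Sum>b\<in>Basis. (v \<bullet> b) *\<^sub>R b)"
    by (simp add: euclidean_representation)
  then show ?thesis
    by (simp add: linear_sum[OF assms] linear_scale[OF assms])
qed

lemma C_n_on_cong:
  assumes "open S" "\<And>x. x \<in> S \<Longrightarrow> f x = g x"
  shows "C_n_on n S f \<longleftrightarrow> C_n_on n S g"
  using assms(2)
proof (induction n arbitrary: f g)
  case 0
  then show ?case by (simp cong: continuous_on_cong)
next
  case (Suc n)
  have d: "(f has_derivative D) (at x) \<longleftrightarrow> (g has_derivative D) (at x)" if "x \<in> S" for x D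
    using has_derivative_transform_within_open[OF _ \<open>open S\<close> that] Suc.prems by metis
  then have "frechet_derivative f (at x) = frechet_derivative g (at x)"
      "f differentiable (at x) \<longleftrightarrow> g differentiable (at x)" if "x \<in> S" for x
    using that by (simp_all add: frechet_derivative_def differentiable_def)
  then show ?case
    by (auto intro!: Suc.IH simp: Suc.IH[of "\<lambda>x. frechet_derivative f (at x) _"])
qed

lemma C_n_on_subset: "C_n_on n S f \<Longrightarrow> T \<subseteq> S \<Longrightarrow> C_n_on n T f"
  by (induction n arbitrary: f) (auto intro: continuous_on_subset)

lemma C_n_on_imp_continuous_on: "C_n_on n S f \<Longrightarrow> continuous_on S f"
  by (cases n)
    (auto intro!: continuous_at_imp_continuous_on differentiable_imp_continuous_within)

lemma C_n_on_Suc_D: "C_n_on (Suc n) S f \<Longrightarrow> C_n_on n S f"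
  by (induction n arbitrary: f)
    (auto intro!: continuous_at_imp_continuous_on differentiable_imp_continuous_within)

lemma C_n_on_Union:
  assumes "\<And>i. i \<in> I \<Longrightarrow> open (U i)" "\<And>i. i \<in> I \<Longrightarrow> C_n_on n (U i) f"
  shows "C_n_on n (\<Union>i\<in>I. U i) f"
  using assms(2)
  by (induction n arbitrary: f) (auto intro!: continuous_on_open_UN assms(1))

text \<open>\<open>frechet_derivative\<close> is a choice operator; this rule lets a closure proof
  offer an explicit formula \<open>f'\<close> and run its induction on that formula.\<close>

lemma C_n_on_SucI:
  assumes "open S" "\<And>x. x \<in> S \<Longrightarrow> (f has_derivative f' x) (at x)"
    and "\<And>v. C_n_on n S (\<lambda>x. f' x v)"
  shows "C_n_on (Suc n) S f"
proof -
  have "frechet_derivative f (at x) = f' x" if "x \<in> S" for x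
    using frechet_derivative_at[OF assms(2)[OF that]] by simp
  then have "C_n_on n S (\<lambda>x. frechet_derivative f (at x) v)" for v
    using C_n_on_cong[OF \<open>open S\<close>, of "\<lambda>x. frechet_derivative f (at x) v" "\<lambda>x. f' x v"] assms(3)
    by simp
  then show ?thesis
    using assms(2) by (auto simp: differentiable_def)
qed

lemma C_n_on_Suc_has_derivative:
  "C_n_on (Suc n) S f \<Longrightarrow> x \<in> S \<Longrightarrow> (f has_derivative frechet_derivative f (at x)) (at x)"
  by (simp add: frechet_derivative_works)

lemma C_n_on_const: "open S \<Longrightarrow> C_n_on n S (\<lambda>x. c)"
  by (induction n arbitrary: c)
    (auto intro!: C_n_on_SucI[where f' = "\<lambda>_ _. 0"] simp del: C_n_on.simps(2))

lemma C_n_on_bounded_linear: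
  assumes "bounded_linear L" "open S" "C_n_on n S f"
  shows "C_n_on n S (\<lambda>x. L (f x))"
  using assms(3)
proof (induction n arbitrary: f)
  case 0
  then show ?case
    by (simp add: bounded_linear.continuous_on[OF assms(1)])
next
  case (Suc n)
  show ?case
  proof (rule C_n_on_SucI[OF \<open>open S\<close>])
    show "((\<lambda>x. L (f x)) has_derivative (\<lambda>v. L (frechet_derivative f (at x) v))) (at x)"
      if "x \<in> S" for x
      using bounded_linear.has_derivative[OF assms(1) C_n_on_Suc_has_derivative[OF Suc.prems that]] .
    show "C_n_on n S (\<lambda>x. L (frechet_derivative f (at x) v))" for v
      using Suc by simp
  qed
qed

lemma C_n_on_id: "open S \<Longrightarrow> C_n_on n S (\<lambda>x. x)"
proof (cases n)
  case (Suc m)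
  assume "open S"
  then show ?thesis
    unfolding Suc
    by (intro C_n_on_SucI[where f' = "\<lambda>_ v. v"] C_n_on_const has_derivative_ident)
qed simp

lemma C_n_on_add:
  assumes "open S" "C_n_on n S f" "C_n_on n S g"
  shows "C_n_on n S (\<lambda>x. f x + g x)"
  using assms(2,3)
proof (induction n arbitrary: f g)
  case 0
  then show ?case by (simp add: continuous_on_add)
next
  case (Suc n)
  show ?case
  proof (rule C_n_on_SucI[OF \<open>open S\<close>])
    show "((\<lambda>x. f x + g x) has_derivative
        (\<lambda>v. frechet_derivative f (at x) v + frechet_derivative g (at x) v)) (at x)"
      if "x \<in> S" for x
      using has_derivative_add C_n_on_Suc_has_derivative Suc.prems that by blast
    show "C_n_on n S (\<lambda>x. frechet_derivative f (at x) v + frechet_derivative g (at x) v)" for v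
      using Suc by simp
  qed
qed

lemma C_n_on_sum:
  assumes "open S" "\<And>i. i \<in> I \<Longrightarrow> C_n_on n S (f i)"
  shows "C_n_on n S (\<lambda>x. \<Sum>i\<in>I. f i x)"
  using assms(2)
  by (induction I rule: infinite_finite_induct) (auto intro: C_n_on_const C_n_on_add assms(1))

lemma C_n_on_bilinear:
  assumes "bounded_bilinear B" "open S" "C_n_on n S f" "C_n_on n S g"
  shows "C_n_on n S (\<lambda>x. B (f x) (g x))"
  using assms(3,4)
proof (induction n arbitrary: f g)
  case 0
  then show ?case by (simp add: bounded_bilinear.continuous_on[OF assms(1)])
next
  case (Suc n)
  show ?case
  proof (rule C_n_on_SucI[OF \<open>open S\<close>])
    show "((\<lambda>x. B (f x) (g x)) has_derivative
        (\<lambda>v. B (f x) (frechet_derivative g (at x) v) + B (frechet_derivative f (at x) v) (g x))) (at x)"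
      if "x \<in> S" for x
      using that by (intro bounded_bilinear.FDERIV[OF assms(1)]
          C_n_on_Suc_has_derivative[OF Suc.prems(1)] C_n_on_Suc_has_derivative[OF Suc.prems(2)])
    show "C_n_on n S (\<lambda>x. B (f x) (frechet_derivative g (at x) v)
        + B (frechet_derivative f (at x) v) (g x))" for v
      by (intro C_n_on_add \<open>open S\<close> Suc.IH) (use Suc.prems C_n_on_Suc_D in auto)
  qed
qed

text \<open>The induction hypothesis controls the derivative of \<open>f\<close> only in a fixed
  direction, while in the chain rule the direction \<open>?g' x v\<close> moves with
  \<open>x\<close>. Expanding the direction in \<open>Basis\<close> separates the two
  dependences.\<close>

lemma C_n_on_compose:
  fixes f :: "'b::euclidean_space \<Rightarrow> 'c::real_normed_vector"
  assumes "open S" "open T" "g ` S \<subseteq> T" "C_n_on n S g" "C_n_on n T f"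
  shows "C_n_on n S (\<lambda>x. f (g x))"
  using assms(4,5)
proof (induction n arbitrary: f)
  case 0
  then show ?case
    using continuous_on_compose2 assms(3) by auto
next
  case (Suc n)
  let ?f' = "\<lambda>z. frechet_derivative f (at z)" and ?g' = "\<lambda>x. frechet_derivative g (at x)"
  show ?case
  proof (rule C_n_on_SucI[OF \<open>open S\<close>])
    fix x assume x: "x \<in> S"
    then have gx: "g x \<in> T" using assms(3) by auto
    have f: "(f has_derivative ?f' (g x)) (at (g x))"
      using C_n_on_Suc_has_derivative[OF Suc.prems(2) gx] .
    have g: "(g has_derivative ?g' x) (at x)"
      using C_n_on_Suc_has_derivative[OF Suc.prems(1) x] .
    have "?f' (g x) (?g' x v) = (\<Sum>b\<in>Basis. (?g' x v \<bullet> b) *\<^sub>R ?f' (g x) b)" for v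
      by (rule linear_Basis_expansion[OF has_derivative_linear[OF f]])
    with diff_chain_at[OF g f]
    show "((\<lambda>x. f (g x)) has_derivative
        (\<lambda>v. \<Sum>b\<in>Basis. (?g' x v \<bullet> b) *\<^sub>R ?f' (g x) b)) (at x)"
      by (simp add: o_def)
  next
    fix v
    show "C_n_on n S (\<lambda>x. \<Sum>b\<in>Basis. (?g' x v \<bullet> b) *\<^sub>R ?f' (g x) b)"
      by (intro C_n_on_sum C_n_on_bilinear[OF bounded_bilinear_scaleR]
          C_n_on_bounded_linear[OF bounded_linear_inner_left] Suc.IH \<open>open S\<close>)
        (use Suc.prems C_n_on_Suc_D in auto)
  qed
qed

text \<open>The derivative of inversion is again a product of inversions, so the induction on the
  order closes. The two-sided form \<open>inverse x * h * inverse x\<close> is due to noncommuting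
  scalars.\<close>

lemma C_n_on_inverse:
  fixes S :: "'a::real_normed_div_algebra set"
  assumes "open S" "0 \<notin> S"
  shows "C_n_on n S (inverse :: 'a \<Rightarrow> 'a)"
proof (induction n)
  case 0
  then show ?case
    using assms by (auto intro!: continuous_on_inverse continuous_on_id)
next
  case (Suc n)
  show ?case
    using assms
    by (intro C_n_on_SucI[where f' = "\<lambda>x h. - (inverse x * h * inverse x)"] has_derivative_inverse'
        C_n_on_bounded_linear[OF bounded_linear_minus[OF bounded_linear_ident]]
        C_n_on_bilinear[OF bounded_bilinear_mult] C_n_on_const Suc) auto
qed

text \<open>Taking \<open>inverse (norm x)\<close> as one function closes the induction: its
  derivative is minus its own cube times the linear factor \<open>x \<bullet> v\<close>.\<close>

lemma C_n_on_inverse_norm: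
  fixes S :: "'a::real_inner set"
  assumes "open S" "0 \<notin> S"
  shows "C_n_on n S (\<lambda>x. inverse (norm x))"
proof (induction n)
  case 0
  then show ?case
    using assms by (auto intro!: continuous_intros)
next
  case (Suc n)
  show ?case
  proof (rule C_n_on_SucI[OF \<open>open S\<close>])
    fix x assume "x \<in> S"
    then have x: "x \<noteq> 0" using assms by auto
    show "((\<lambda>x. inverse (norm x)) has_derivative
        (\<lambda>v. - (inverse (norm x) * (inverse (norm x) * (inverse (norm x) * (x \<bullet> v)))))) (at x)"
      using x by (auto intro!: derivative_eq_intros has_derivative_norm
          simp: sgn_div_norm inner_commute field_simps)
  next
    fix v
    show "C_n_on n S
        (\<lambda>x. - (inverse (norm x) * (inverse (norm x) * (inverse (norm x) * (x \<bullet> v)))))"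
      by (intro C_n_on_bounded_linear[OF bounded_linear_minus[OF bounded_linear_ident]]
          C_n_on_bilinear[OF bounded_bilinear_mult] Suc \<open>open S\<close>
          C_n_on_bounded_linear[OF bounded_linear_inner_left] C_n_on_id)
  qed
qed

section \<open>Closure properties of smooth maps\<close>

lemma smooth_on_cong: "open S \<Longrightarrow> (\<And>x. x \<in> S \<Longrightarrow> f x = g x) \<Longrightarrow> smooth_on S f \<longleftrightarrow> smooth_on S g"
  using C_n_on_cong unfolding smooth_on_def by metis

lemma smooth_on_subset: "smooth_on S f \<Longrightarrow> T \<subseteq> S \<Longrightarrow> smooth_on T f"
  unfolding smooth_on_def by (blast intro: C_n_on_subset)

lemma smooth_on_imp_continuous_on: "smooth_on S f \<Longrightarrow> continuous_on S f"
  unfolding smooth_on_def by (blast intro: C_n_on_imp_continuous_on)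

lemma smooth_on_Union:
  "(\<And>i. i \<in> I \<Longrightarrow> open (U i)) \<Longrightarrow> (\<And>i. i \<in> I \<Longrightarrow> smooth_on (U i) f) \<Longrightarrow>
    smooth_on (\<Union>i\<in>I. U i) f"
  unfolding smooth_on_def by (blast intro: C_n_on_Union)

lemma smooth_on_const: "open S \<Longrightarrow> smooth_on S (\<lambda>x. c)"
  unfolding smooth_on_def by (blast intro: C_n_on_const)

lemma smooth_on_bounded_linear:
  "bounded_linear L \<Longrightarrow> open S \<Longrightarrow> smooth_on S f \<Longrightarrow> smooth_on S (\<lambda>x. L (f x))"
  unfolding smooth_on_def by (blast intro: C_n_on_bounded_linear)

lemma smooth_on_id: "open S \<Longrightarrow> smooth_on S (\<lambda>x. x)"
  unfolding smooth_on_def by (blast intro: C_n_on_id)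

lemma smooth_on_add:
  "open S \<Longrightarrow> smooth_on S f \<Longrightarrow> smooth_on S g \<Longrightarrow> smooth_on S (\<lambda>x. f x + g x)"
  unfolding smooth_on_def by (blast intro: C_n_on_add)

lemma smooth_on_bilinear:
  "bounded_bilinear B \<Longrightarrow> open S \<Longrightarrow> smooth_on S f \<Longrightarrow> smooth_on S g \<Longrightarrow>
    smooth_on S (\<lambda>x. B (f x) (g x))"
  unfolding smooth_on_def by (blast intro: C_n_on_bilinear)

lemma smooth_on_compose:
  fixes f :: "'b::euclidean_space \<Rightarrow> 'c::real_normed_vector"
  shows "open S \<Longrightarrow> open T \<Longrightarrow> g ` S \<subseteq> T \<Longrightarrow> smooth_on S g \<Longrightarrow> smooth_on T f \<Longrightarrow>
    smooth_on S (\<lambda>x. f (g x))"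
  unfolding smooth_on_def by (blast intro: C_n_on_compose)

lemma smooth_on_inverse:
  fixes f :: "'a::real_normed_vector \<Rightarrow> 'b::{real_normed_div_algebra, euclidean_space}"
  assumes "open S" "smooth_on S f" "\<And>x. x \<in> S \<Longrightarrow> f x \<noteq> 0"
  shows "smooth_on S (\<lambda>x. inverse (f x))"
  by (rule smooth_on_compose[of S "- {0}" f inverse])
    (use assms in \<open>auto simp: smooth_on_def intro!: C_n_on_inverse\<close>)

lemma smooth_on_normalize:
  fixes f :: "'a::real_normed_vector \<Rightarrow> 'b::euclidean_space"
  assumes "open S" "smooth_on S f" "\<And>x. x \<in> S \<Longrightarrow> f x \<noteq> 0"
  shows "smooth_on S (\<lambda>x. f x /\<^sub>R norm (f x))"
proof (rule smooth_on_bilinear[OF bounded_bilinear_scaleR \<open>open S\<close> _ assms(2)])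
  show "smooth_on S (\<lambda>x. inverse (norm (f x)))"
    by (rule smooth_on_compose[of S "- {0}" f "\<lambda>y. inverse (norm y)"])
      (use assms in \<open>auto simp: smooth_on_def intro!: C_n_on_inverse_norm\<close>)
qed


section \<open>Second derivatives\<close>

lemma has_derivative_transform_nhds:
  assumes "(f has_derivative D) (at x)" "\<forall>\<^sub>F y in nhds x. f y = g y"
  shows "(g has_derivative D) (at x)"
  by (rule has_derivative_transform_eventually[OF assms(1)])
    (use assms(2) in \<open>auto simp: eventually_at_filter elim: eventually_mono
      dest: eventually_nhds_x_imp_x\<close>)

text \<open>Differentiating \<open>f' y v\<close> at fixed \<open>v\<close> avoids a norm on spaces
  of linear maps. In \<open>f'' w v\<close> the second differentiation is along
  \<open>w\<close>.\<close>

definition has_second_derivative ::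
    "('a::euclidean_space \<Rightarrow> 'b::real_normed_vector) \<Rightarrow> ('a \<Rightarrow> 'a \<Rightarrow> 'b) \<Rightarrow> ('a \<Rightarrow> 'a \<Rightarrow> 'b) \<Rightarrow> 'a \<Rightarrow> bool"
  where "has_second_derivative f f' f'' x \<longleftrightarrow>
    (\<forall>\<^sub>F y in nhds x. (f has_derivative f' y) (at y)) \<and>
    (\<forall>v. ((\<lambda>y. f' y v) has_derivative (\<lambda>w. f'' w v)) (at x))"

lemma has_second_derivativeD:
  assumes "has_second_derivative f f' f'' x"
  shows "(f has_derivative f' x) (at x)" "((\<lambda>y. f' y v) has_derivative (\<lambda>w. f'' w v)) (at x)"
  using assms eventually_nhds_x_imp_x unfolding has_second_derivative_def by fast+

lemma smooth_on_has_second_derivative: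
  assumes "smooth_on S f" "open S" "x \<in> S"
  shows "has_second_derivative f (\<lambda>y. frechet_derivative f (at y))
    (\<lambda>w v. frechet_derivative (\<lambda>y. frechet_derivative f (at y) v) (at x) w) x"
proof -
  have "C_n_on (Suc (Suc 0)) S f"
    using assms(1) unfolding smooth_on_def by blast
  then show ?thesis
    unfolding has_second_derivative_def eventually_nhds
    using assms(2,3) by (auto simp: frechet_derivative_works intro!: exI[of _ S])
qed

lemma has_second_derivative_cong:
  assumes "has_second_derivative f f' f'' x" "\<forall>\<^sub>F y in nhds x. g y = f y"
  shows "has_second_derivative g f' f'' x"
proof -
  have "\<forall>\<^sub>F y in nhds x. \<forall>\<^sub>F z in nhds y. g z = f z"
    using assms(2) by (simp add: eventually_eventually)
  moreover have "\<forall>\<^sub>F y in nhds x. (f has_derivative f' y) (at y)"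
    using assms(1) by (simp add: has_second_derivative_def)
  ultimately have "\<forall>\<^sub>F y in nhds x. (g has_derivative f' y) (at y)"
  proof eventually_elim
    case (elim y)
    have "\<forall>\<^sub>F z in nhds y. f z = g z"
      using elim(1) by eventually_elim simp
    with elim(2) show ?case
      by (rule has_derivative_transform_nhds)
  qed
  with assms(1) show ?thesis
    by (simp add: has_second_derivative_def)
qed

lemma has_second_derivative_bounded_linear:
  assumes "bounded_linear L" "has_second_derivative f f' f'' x"
  shows "has_second_derivative (\<lambda>y. L (f y)) (\<lambda>y v. L (f' y v)) (\<lambda>w v. L (f'' w v)) x"
  using assms unfolding has_second_derivative_def
  by (auto elim!: eventually_mono intro: bounded_linear.has_derivative)

text \<open>A product rule for a linear map and a vector that both move, when \<open>A\<close> is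
  known to be differentiable only on fixed vectors. Expansion in \<open>Basis\<close> reduces it to
  finitely many products with a real factor.\<close>

lemma has_derivative_apply:
  fixes u :: "'a::real_normed_vector \<Rightarrow> 'b::euclidean_space"
  assumes lin: "\<forall>\<^sub>F y in nhds x. linear (A y)"
    and A: "\<And>b. ((\<lambda>y. A y b) has_derivative (\<lambda>w. A' w b)) (at x)"
    and u: "(u has_derivative u') (at x)"
  shows "((\<lambda>y. A y (u y)) has_derivative (\<lambda>w. A' w (u x) + A x (u' w))) (at x)"
proof -
  have linx: "linear (A x)"
    using lin by (rule eventually_nhds_x_imp_x)
  note expand = linear_Basis_expansion
  have "((\<lambda>y. A y v) has_derivative (\<lambda>w. \<Sum>b\<in>Basis. (v \<bullet> b) *\<^sub>R A' w b)) (at x)" for v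
  proof (rule has_derivative_transform_nhds)
    show "((\<lambda>y. \<Sum>b\<in>Basis. (v \<bullet> b) *\<^sub>R A y b) has_derivative
        (\<lambda>w. \<Sum>b\<in>Basis. (v \<bullet> b) *\<^sub>R A' w b)) (at x)"
      by (auto intro!: derivative_eq_intros A)
    show "\<forall>\<^sub>F y in nhds x. (\<Sum>b\<in>Basis. (v \<bullet> b) *\<^sub>R A y b) = A y v"
      using lin by eventually_elim (rule expand[symmetric])
  qed
  \<comment> \<open>Linearity of \<open>A y\<close> near \<open>x\<close> passes to
    \<open>A' w\<close> by uniqueness of derivatives.\<close>
  from has_derivative_unique[OF this A]
  have A': "(\<Sum>b\<in>Basis. (v \<bullet> b) *\<^sub>R A' w b) = A' w v" for w v
    by (rule fun_cong)
  have "((\<lambda>y. \<Sum>b\<in>Basis. (u y \<bullet> b) *\<^sub>R A y b) has_derivative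
      (\<lambda>w. \<Sum>b\<in>Basis. (u x \<bullet> b) *\<^sub>R A' w b + (u' w \<bullet> b) *\<^sub>R A x b)) (at x)"
    by (auto intro!: derivative_eq_intros A u)
  then have "((\<lambda>y. \<Sum>b\<in>Basis. (u y \<bullet> b) *\<^sub>R A y b) has_derivative
      (\<lambda>w. A' w (u x) + A x (u' w))) (at x)"
    by (simp add: sum.distrib A' flip: expand[OF linx])
  then show ?thesis
  proof (rule has_derivative_transform_nhds)
    show "\<forall>\<^sub>F y in nhds x. (\<Sum>b\<in>Basis. (u y \<bullet> b) *\<^sub>R A y b) = A y (u y)"
      using lin by eventually_elim (rule expand[symmetric])
  qed
qed

lemma has_second_derivative_compose:
  fixes g :: "'a::euclidean_space \<Rightarrow> 'b::euclidean_space"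
  assumes g: "has_second_derivative g g' g'' x" and f: "has_second_derivative f f' f'' (g x)"
  shows "has_second_derivative (\<lambda>y. f (g y)) (\<lambda>y v. f' (g y) (g' y v))
    (\<lambda>w v. f'' (g' x w) (g' x v) + f' (g x) (g'' w v)) x"
  unfolding has_second_derivative_def
proof (intro conjI allI)
  have cont: "filterlim g (nhds (g x)) (nhds x)"
    using has_derivative_continuous[OF has_second_derivativeD(1)[OF g]]
    by (metis continuous_within tendsto_at_iff_tendsto_nhds)
  have f1: "\<forall>\<^sub>F y in nhds x. (f has_derivative f' (g y)) (at (g y))"
    using f eventually_compose_filterlim[OF _ cont] unfolding has_second_derivative_def by blast
  have g1: "\<forall>\<^sub>F y in nhds x. (g has_derivative g' y) (at y)"
    using g unfolding has_second_derivative_def by blast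
  show "\<forall>\<^sub>F y in nhds x. ((\<lambda>y. f (g y)) has_derivative (\<lambda>v. f' (g y) (g' y v))) (at y)"
    using f1 g1 by eventually_elim (use diff_chain_at in \<open>force simp: o_def\<close>)
  fix v
  show "((\<lambda>y. f' (g y) (g' y v)) has_derivative
      (\<lambda>w. f'' (g' x w) (g' x v) + f' (g x) (g'' w v))) (at x)"
  proof (rule has_derivative_apply[where A' = "\<lambda>w. f'' (g' x w)"])
    have "\<forall>\<^sub>F y in nhds x. linear (f' (g y))"
      using f1 by eventually_elim (rule has_derivative_linear)
    then show "\<forall>\<^sub>F y in nhds x. linear (f' (g y))" .
    show "((\<lambda>y. f' (g y) b) has_derivative (\<lambda>w. f'' (g' x w) b)) (at x)" for b
      using diff_chain_at[OF has_second_derivativeD(1)[OF g] has_second_derivativeD(2)[OF f, of b]]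
      by (simp add: o_def)
    show "((\<lambda>y. g' y v) has_derivative (\<lambda>w. g'' w v)) (at x)"
      using has_second_derivativeD(2)[OF g] .
  qed
qed

text \<open>The mean value theorem along \<open>v\<close> turns the second difference into a
  difference of first derivatives, which differentiability of \<open>\<lambda>y. f' y v\<close> at
  \<open>x\<close> evaluates. The quotient is visibly symmetric in \<open>v\<close> and
  \<open>w\<close>, its limit is not.\<close>

lemma second_difference_quotient_tendsto:
  fixes f :: "'a::euclidean_space \<Rightarrow> real"
  assumes f: "has_second_derivative f f' f'' x"
  shows "((\<lambda>t. (f (x + t *\<^sub>R v + t *\<^sub>R w) - f (x + t *\<^sub>R v) - f (x + t *\<^sub>R w) + f x) / t\<^sup>2)
    \<longlongrightarrow> f'' w v) (at_right 0)"
proof (rule tendstoI)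
  fix \<epsilon> :: real assume \<epsilon>: "0 < \<epsilon>"
  \<comment> \<open>\<open>t * M\<close> bounds the distance from \<open>x\<close> of all points
    that occur. The 4 in \<open>\<delta>\<close> makes the two linearization errors, each at most
    \<open>\<delta> * (t * M)\<close>, add up to \<open>t * (\<epsilon> / 2)\<close>; the other half
    of \<open>\<epsilon>\<close> gives the strict inequality.\<close>
  define M where "M = norm v + norm w + 1"
  define \<delta> where "\<delta> = \<epsilon> / (4 * M)"
  have M: "M > 0" by (simp add: M_def add_nonneg_pos)
  then have \<delta>: "\<delta> > 0" using \<epsilon> by (simp add: \<delta>_def)
  obtain r where r: "r > 0" and f1: "\<And>y. dist y x < r \<Longrightarrow> (f has_derivative f' y) (at y)"
    using f unfolding has_second_derivative_def eventually_nhds_metric by blast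
  have lin: "linear (\<lambda>w. f'' w v)"
    using has_derivative_linear[OF has_second_derivativeD(2)[OF f]] .
  obtain d where d: "d > 0"
    and f2: "\<And>y. norm (y - x) < d \<Longrightarrow> norm (f' y v - f' x v - f'' (y - x) v) \<le> \<delta> * norm (y - x)"
    using has_second_derivativeD(2)[OF f, of v] \<delta> unfolding has_derivative_at_alt by metis
  have "dist ((f (x + t *\<^sub>R v + t *\<^sub>R w) - f (x + t *\<^sub>R v) - f (x + t *\<^sub>R w) + f x) / t\<^sup>2) (f'' w v) < \<epsilon>"
    if t: "0 < t" "t < min r d / M" for t
  proof -
    have near: "norm (s *\<^sub>R v + u *\<^sub>R w) \<le> t * M" if "0 \<le> s" "s \<le> t" "0 \<le> u" "u \<le> t" for s u
    proof -
      have "norm (s *\<^sub>R v + u *\<^sub>R w) \<le> s * norm v + u * norm w"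
        using norm_triangle_ineq[of "s *\<^sub>R v" "u *\<^sub>R w"] that by simp
      also have "\<dots> \<le> t * norm v + t * norm w"
        using that by (intro add_mono mult_right_mono) auto
      also have "\<dots> \<le> t * M"
        using t by (simp add: M_def algebra_simps)
      finally show ?thesis .
    qed
    have tM: "t * M < r" "t * M < d"
      using t M by (auto simp: field_simps)
    let ?k = "\<lambda>s. f (x + s *\<^sub>R v + t *\<^sub>R w) - f (x + s *\<^sub>R v)"
    have "(?k has_derivative (\<lambda>h. f' (x + s *\<^sub>R v + t *\<^sub>R w) (h *\<^sub>R v) - f' (x + s *\<^sub>R v) (h *\<^sub>R v)))
        (at s)" if "0 \<le> s" "s \<le> t" for s
    proof (rule has_derivative_diff)
      have "dist (x + s *\<^sub>R v + t *\<^sub>R w) x < r" "dist (x + s *\<^sub>R v) x < r"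
        using near[of s t] near[of s 0] that tM t by (auto simp: dist_norm algebra_simps)
      note D = this[THEN f1]
      show "((\<lambda>s. f (x + s *\<^sub>R v + t *\<^sub>R w)) has_derivative
          (\<lambda>h. f' (x + s *\<^sub>R v + t *\<^sub>R w) (h *\<^sub>R v))) (at s)"
        by (rule has_derivative_compose[where f = "\<lambda>s. x + s *\<^sub>R v + t *\<^sub>R w", OF _ D(1)])
          (auto intro!: derivative_eq_intros)
      show "((\<lambda>s. f (x + s *\<^sub>R v)) has_derivative (\<lambda>h. f' (x + s *\<^sub>R v) (h *\<^sub>R v))) (at s)"
        by (rule has_derivative_compose[where f = "\<lambda>s. x + s *\<^sub>R v", OF _ D(2)])
          (auto intro!: derivative_eq_intros)
    qed
    from mvt_simple[OF \<open>0 < t\<close> has_derivative_at_withinI[OF this]]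
    obtain s where s: "0 < s" "s < t"
      and k: "?k t - ?k 0 = f' (x + s *\<^sub>R v + t *\<^sub>R w) (t *\<^sub>R v) - f' (x + s *\<^sub>R v) (t *\<^sub>R v)"
      by auto
    have D: "dist (x + s *\<^sub>R v + t *\<^sub>R w) x < r" "dist (x + s *\<^sub>R v) x < r"
      using near[of s t] near[of s 0] s tM t by (auto simp: dist_norm algebra_simps)
    have k': "?k t - ?k 0 = t * (f' (x + s *\<^sub>R v + t *\<^sub>R w) v - f' (x + s *\<^sub>R v) v)"
      unfolding k using linear_scale[OF has_derivative_linear[OF f1[OF D(1)]]]
        linear_scale[OF has_derivative_linear[OF f1[OF D(2)]]] by (simp add: algebra_simps)
    have e1: "\<bar>f' (x + s *\<^sub>R v + t *\<^sub>R w) v - f' x v - f'' (s *\<^sub>R v + t *\<^sub>R w) v\<bar> \<le> \<delta> * (t * M)"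
    proof -
      have "norm (f' (x + s *\<^sub>R v + t *\<^sub>R w) v - f' x v - f'' (x + s *\<^sub>R v + t *\<^sub>R w - x) v)
        \<le> \<delta> * norm (x + s *\<^sub>R v + t *\<^sub>R w - x)"
        using near[of s t] s tM t by (intro f2) (auto simp: algebra_simps)
      also have "\<dots> \<le> \<delta> * (t * M)"
        using near[of s t] s t \<delta> by (intro mult_left_mono) (auto simp: algebra_simps)
      finally show ?thesis by (simp add: algebra_simps)
    qed
    have e2: "\<bar>f' (x + s *\<^sub>R v) v - f' x v - f'' (s *\<^sub>R v) v\<bar> \<le> \<delta> * (t * M)"
    proof -
      have "norm (f' (x + s *\<^sub>R v) v - f' x v - f'' (x + s *\<^sub>R v - x) v)
        \<le> \<delta> * norm (x + s *\<^sub>R v - x)"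
        using near[of s 0] s tM t by (intro f2) (auto simp: algebra_simps)
      also have "\<dots> \<le> \<delta> * (t * M)"
        using near[of s 0] s t \<delta> by (intro mult_left_mono) (auto simp: algebra_simps)
      finally show ?thesis by (simp add: algebra_simps)
    qed
    have "f'' (s *\<^sub>R v + t *\<^sub>R w) v = f'' (s *\<^sub>R v) v + t * f'' w v"
      using linear_add[OF lin] linear_scale[OF lin] by simp
    with e1 e2 have "\<bar>(f' (x + s *\<^sub>R v + t *\<^sub>R w) v - f' (x + s *\<^sub>R v) v) - t * f'' w v\<bar> \<le> 2 * (\<delta> * (t * M))"
      by linarith
    also have "\<dots> = t * (\<epsilon> / 2)"
      using M by (simp add: \<delta>_def)
    finally have "\<bar>(?k t - ?k 0) / t - t * f'' w v\<bar> \<le> t * (\<epsilon> / 2)"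
      unfolding k' using t by simp
    moreover have quot: "\<bar>a / t - t * L\<bar> / t = \<bar>a / t\<^sup>2 - L\<bar>" for a L :: real
    proof -
      have "(a / t - t * L) / t = a / t\<^sup>2 - L"
        using t by (simp add: field_simps power2_eq_square)
      then show ?thesis
        using t by (metis abs_divide abs_of_pos)
    qed
    ultimately have "\<bar>(?k t - ?k 0) / t - t * f'' w v\<bar> / t \<le> \<epsilon> / 2"
      using t by (simp add: field_simps)
    also have "\<bar>(?k t - ?k 0) / t - t * f'' w v\<bar> / t = \<bar>(?k t - ?k 0) / t\<^sup>2 - f'' w v\<bar>"
      by (rule quot)
    finally show ?thesis
      using \<epsilon> by (simp add: dist_real_def algebra_simps)
  qed
  moreover have "min r d / M > 0"
    using r d M by simp
  ultimately show "\<forall>\<^sub>F t in at_right 0.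
      dist ((f (x + t *\<^sub>R v + t *\<^sub>R w) - f (x + t *\<^sub>R v) - f (x + t *\<^sub>R w) + f x) / t\<^sup>2) (f'' w v) < \<epsilon>"
    unfolding eventually_at_right_field by blast
qed

text \<open>Swapping \<open>v\<close> and \<open>w\<close> does not change the second difference,
  and limits are unique. The mean value theorem concerns real functions, hence the passage to
  components.\<close>

lemma second_derivative_symmetric:
  fixes f :: "'a::euclidean_space \<Rightarrow> 'b::euclidean_space"
  assumes "has_second_derivative f f' f'' x"
  shows "f'' v w = f'' w v"
proof (rule euclidean_eqI)
  fix b :: 'b
  have b: "has_second_derivative (\<lambda>y. f y \<bullet> b) (\<lambda>y v. f' y v \<bullet> b) (\<lambda>w v. f'' w v \<bullet> b) x"
    using has_second_derivative_bounded_linear[OF bounded_linear_inner_left assms] .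
  have swap: "x + t *\<^sub>R w + t *\<^sub>R v = x + t *\<^sub>R v + t *\<^sub>R w" for t
    by (simp add: algebra_simps)
  show "f'' v w \<bullet> b = f'' w v \<bullet> b"
    using second_difference_quotient_tendsto[OF b, of w v]
      second_difference_quotient_tendsto[OF b, of v w]
    by (intro tendsto_unique[OF trivial_limit_at_right_real]) (simp_all add: swap algebra_simps)
qed


section \<open>Frames\<close>

lemma inner_Basis_sum:
  assumes "linear l"
  shows "(\<Sum>b\<in>Basis. l b *\<^sub>R b) \<bullet> w = l w"
proof -
  have "(\<Sum>b\<in>Basis. l b *\<^sub>R b) \<bullet> w = (\<Sum>b\<in>Basis. (w \<bullet> b) *\<^sub>R l b)"
    unfolding inner_sum_left by (intro sum.cong) (simp_all add: inner_commute)
  then show ?thesis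
    by (simp only: linear_Basis_expansion[OF assms, of w])
qed

definition inner_form :: "('a::real_vector \<Rightarrow> 'a \<Rightarrow> real) \<Rightarrow> bool"
  where "inner_form G \<longleftrightarrow>
    (\<forall>v. linear (G v)) \<and> (\<forall>v w. G v w = G w v) \<and> (\<forall>v. v \<noteq> 0 \<longrightarrow> G v v > 0)"

text \<open>The free index type allows frames indexed by a disjoint sum \<open>I <+> C\<close> of
  horizontal and vertical indices.\<close>

definition orthonormal_frame ::
    "('a::euclidean_space \<Rightarrow> 'a \<Rightarrow> real) \<Rightarrow> 'i set \<Rightarrow> ('i \<Rightarrow> 'a) \<Rightarrow> bool"
  where "orthonormal_frame G I e \<longleftrightarrow> finite I \<and> card I = DIM('a) \<and>
    (\<forall>i\<in>I. \<forall>j\<in>I. G (e i) (e j) = (if i = j then 1 else 0))"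

lemma inner_form_linear:
  assumes "inner_form G"
  shows "linear (G v)" "linear (\<lambda>v. G v w)"
proof -
  show lin: "linear (G v)" for v
    using assms unfolding inner_form_def by blast
  have "(\<lambda>v. G v w) = G w"
    using assms unfolding inner_form_def by blast
  then show "linear (\<lambda>v. G v w)"
    using lin by simp
qed

lemma inner_form_sym: "inner_form G \<Longrightarrow> G v w = G w v"
  unfolding inner_form_def by blast

lemma inner_form_eqI:
  assumes "inner_form G" "\<And>w. G u w = G v w"
  shows "u = v"
proof (rule ccontr)
  assume "u \<noteq> v"
  then have "G (u - v) (u - v) > 0"
    using assms(1) unfolding inner_form_def by simp
  then show False
    using assms linear_diff[OF inner_form_linear(2)[OF assms(1)]] by simp
qed

lemma inner_form_pullback:
  assumes "linear L" "inj L"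
  shows "inner_form (\<lambda>v w. L v \<bullet> L w)"
  unfolding inner_form_def
proof (intro conjI allI impI)
  show "linear (\<lambda>w. L v \<bullet> L w)" for v
    using linear_compose[OF assms(1) bounded_linear.linear[OF bounded_linear_inner_right]] by (simp add: o_def)
  show "L v \<bullet> L w = L w \<bullet> L v" for v w
    by (rule inner_commute)
  show "L v \<bullet> L v > 0" if "v \<noteq> 0" for v
    using that linear_injective_0[OF assms(1)] assms(2) by auto
qed

text \<open>Positivity makes the index-lowering map injective, hence surjective in finite dimension.
  This is what makes the \<open>THE\<close> in \<open>grad\<close> and \<open>christoffel\<close>
  denote.\<close>

lemma inner_form_represents:
  fixes G :: "'a::euclidean_space \<Rightarrow> 'a \<Rightarrow> real"
  assumes G: "inner_form G" and l: "linear l"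
  shows "\<exists>!v. \<forall>w. G v w = l w"
proof -
  let ?A = "\<lambda>v. \<Sum>b\<in>Basis. G v b *\<^sub>R b"
  have A: "?A v \<bullet> w = G v w" for v w
    by (rule inner_Basis_sum[OF inner_form_linear(1)[OF G]])
  have "linear ?A"
    by (intro linearI) (simp_all add: linear_add[OF inner_form_linear(2)[OF G]]
        linear_scale[OF inner_form_linear(2)[OF G]] scaleR_add_left sum.distrib scaleR_sum_right)
  moreover have "inj ?A"
    using A inner_form_eqI[OF G] by (intro injI) metis
  ultimately have "surj ?A"
    by (rule linear_inj_imp_surj)
  then obtain v where v: "?A v = (\<Sum>b\<in>Basis. l b *\<^sub>R b)"
    by (metis (no_types, lifting) surjD)
  have "G v w = l w" for w
  proof -
    have "G v w = (\<Sum>b\<in>Basis. l b *\<^sub>R b) \<bullet> w"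
      unfolding v[symmetric] by (rule A[symmetric])
    also have "\<dots> = l w"
      by (rule inner_Basis_sum[OF l])
    finally show ?thesis .
  qed
  then show ?thesis
    using inner_form_eqI[OF G] by metis
qed

text \<open>An orthonormal family is independent, and its size is the dimension, so it spans. The
  remainder \<open>u\<close> is orthogonal to the family, hence to itself.\<close>

lemma orthonormal_frame_expansion:
  fixes G :: "'a::euclidean_space \<Rightarrow> 'a \<Rightarrow> real"
  assumes G: "inner_form G" and e: "orthonormal_frame G I e"
  shows "v = (\<Sum>i\<in>I. G v (e i) *\<^sub>R e i)"
proof -
  have fin: "finite I" and card: "card I = DIM('a)"
    and on: "\<And>i j. i \<in> I \<Longrightarrow> j \<in> I \<Longrightarrow> G (e i) (e j) = (if i = j then 1 else 0)"
    using e unfolding orthonormal_frame_def by auto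
  note lin = inner_form_linear(2)[OF G]
  have coeff: "G (\<Sum>i\<in>I. c i *\<^sub>R e i) (e j) = c j" if "j \<in> I" for c j
  proof -
    have "G (\<Sum>i\<in>I. c i *\<^sub>R e i) (e j) = (\<Sum>i\<in>I. c i * (if i = j then 1 else 0))"
      using that on by (simp add: linear_sum[OF lin] linear_scale[OF lin])
    then show ?thesis
      using that fin by (simp add: if_distrib cong: if_cong)
  qed
  have inj: "inj_on e I"
    using on by (intro inj_onI) (metis zero_neq_one)
  have "independent (e ` I)"
  proof (rule independent_if_scalars_zero)
    show "finite (e ` I)" using fin by simp
    fix c x assume c: "(\<Sum>y\<in>e ` I. c y *\<^sub>R y) = 0" and "x \<in> e ` I"
    then obtain j where j: "j \<in> I" "x = e j" by auto
    have "(\<Sum>i\<in>I. c (e i) *\<^sub>R e i) = 0"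
      using c by (simp add: sum.reindex[OF inj])
    then have "c (e j) = G 0 (e j)"
      using coeff[OF j(1), of "c \<circ> e"] by simp
    then show "c x = 0"
      using j linear_0[OF lin] by simp
  qed
  then have "UNIV \<subseteq> span (e ` I)"
    by (intro card_ge_dim_independent) (simp_all add: card_image[OF inj] card)
  define u where "u = v - (\<Sum>i\<in>I. G v (e i) *\<^sub>R e i)"
  have "G u (e j) = 0" if "j \<in> I" for j
    using coeff[OF that] by (simp add: u_def linear_diff[OF lin])
  moreover have "subspace {z. G u z = 0}"
    using linear_add[OF inner_form_linear(1)[OF G]] linear_scale[OF inner_form_linear(1)[OF G]]
      linear_0[OF inner_form_linear(1)[OF G]] by (simp add: subspace_def)
  ultimately have "span (e ` I) \<subseteq> {z. G u z = 0}"
    by (intro span_minimal) auto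
  with \<open>UNIV \<subseteq> span (e ` I)\<close> have "G u u = 0" by auto
  then have "u = 0"
    using G unfolding inner_form_def by force
  then show ?thesis by (simp add: u_def)
qed

text \<open>\<open>divergence\<close> takes its trace in the Euclidean basis of the model, which is
  unrelated to \<open>G\<close>; independence of the trace from the basis links it to
  frames.\<close>

lemma trace_orthonormal_frame:
  fixes G :: "'a::euclidean_space \<Rightarrow> 'a \<Rightarrow> real"
  assumes G: "inner_form G" and e: "orthonormal_frame G I e" and L: "linear L"
  shows "(\<Sum>b\<in>Basis. L b \<bullet> b) = (\<Sum>i\<in>I. G (L (e i)) (e i))"
proof -
  have lin: "linear (\<lambda>u. G (L u) v)" for v
    using linear_compose[OF L inner_form_linear(2)[OF G]] by (simp add: o_def)
  have "(\<Sum>b\<in>Basis. L b \<bullet> b) = (\<Sum>b\<in>Basis. (\<Sum>i\<in>I. G (L b) (e i) *\<^sub>R e i) \<bullet> b)"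
    using orthonormal_frame_expansion[OF G e] by metis
  also have "\<dots> = (\<Sum>i\<in>I. \<Sum>b\<in>Basis. (e i \<bullet> b) * G (L b) (e i))"
    unfolding inner_sum_left by (subst sum.swap) (simp add: mult.commute)
  also have "\<dots> = (\<Sum>i\<in>I. G (L (e i)) (e i))"
    by (simp only: real_scaleR_def[symmetric] linear_Basis_expansion[OF lin, symmetric])
  finally show ?thesis .
qed

text \<open>An orthonormal basis of the range is pulled back by \<open>inv L\<close>; its vectors
  serve as their own indices.\<close>

lemma orthonormal_frame_pullback_exists:
  fixes L :: "'a::euclidean_space \<Rightarrow> 'b::euclidean_space"
  assumes L: "linear L" "inj L"
  shows "\<exists>(I :: 'b set) e. orthonormal_frame (\<lambda>v w. L v \<bullet> L w) I e"
proof -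
  obtain B where B: "B \<subseteq> range L" "pairwise orthogonal B" "\<And>b. b \<in> B \<Longrightarrow> norm b = 1"
      "independent B" "card B = dim (range L)"
    using orthonormal_basis_subspace[OF linear_subspace_image[OF L(1) subspace_UNIV]] by metis
  have "dim (range L) = DIM('a)"
    using dim_image_eq[OF L(1), of UNIV] L(2) by simp
  moreover have "finite B"
    using B(4) by (rule independent_imp_finite)
  moreover have "L (inv L b) = b" if "b \<in> B" for b
    using that B(1) by (intro f_inv_into_f) auto
  ultimately have "orthonormal_frame (\<lambda>v w. L v \<bullet> L w) B (inv L)"
    using B(2,3,5) unfolding orthonormal_frame_def pairwise_def orthogonal_def
    by (auto simp: norm_eq_1)
  then show ?thesis by blast
qed


section \<open>Gradient and Laplacian in a frame\<close>

text \<open>A factor tending to 0 times a factor of order \<open>norm (y - x)\<close> is of smaller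
  order. In the application \<open>u\<close> is a coordinate of a map known so far only to be
  continuous, which rules out the usual product rule.\<close>

lemma has_derivative_scaleR_vanishing:
  fixes u :: "'a::real_normed_vector \<Rightarrow> real" and v :: "'a \<Rightarrow> 'b::real_normed_vector"
  assumes "isCont u x" "u x = 0" "(v has_derivative v') (at x)" "v x = 0"
  shows "((\<lambda>y. u y *\<^sub>R v y) has_derivative (\<lambda>_. 0)) (at x)"
proof -
  obtain K where K: "K > 0" "\<And>h. norm (v' h) \<le> norm h * K"
    using bounded_linear.pos_bounded[OF has_derivative_bounded_linear[OF assms(3)]] by blast
  obtain d1 where d1: "d1 > 0"
      "\<And>y. norm (y - x) < d1 \<Longrightarrow> norm (v y - v x - v' (y - x)) \<le> 1 * norm (y - x)"
    using assms(3) unfolding has_derivative_at_alt by (metis zero_less_one)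
  have v: "norm (v y) \<le> (K + 1) * norm (y - x)" if "norm (y - x) < d1" for y
    using d1(2)[OF that] K(2)[of "y - x"] norm_triangle_ineq2[of "v y" "v' (y - x)"] assms(4)
    by (simp add: algebra_simps)
  show ?thesis
    unfolding has_derivative_at_alt
  proof (intro conjI allI impI)
    fix \<epsilon> :: real assume "\<epsilon> > 0"
    then have "\<epsilon> / (K + 1) > 0" using K by simp
    then obtain d2 where d2: "d2 > 0" "\<And>y. norm (y - x) < d2 \<Longrightarrow> \<bar>u y\<bar> < \<epsilon> / (K + 1)"
      using assms(1,2) unfolding continuous_at_eps_delta dist_norm by fastforce
    show "\<exists>d>0. \<forall>y. norm (y - x) < d \<longrightarrow>
        norm (u y *\<^sub>R v y - u x *\<^sub>R v x - 0) \<le> \<epsilon> * norm (y - x)"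
    proof (intro exI[of _ "min d1 d2"] conjI allI impI)
      fix y assume y: "norm (y - x) < min d1 d2"
      have "\<bar>u y\<bar> * norm (v y) \<le> \<epsilon> / (K + 1) * ((K + 1) * norm (y - x))"
        using d2(2)[of y] v[of y] y by (intro mult_mono) auto
      then show "norm (u y *\<^sub>R v y - u x *\<^sub>R v x - 0) \<le> \<epsilon> * norm (y - x)"
        using assms K by simp
    qed (use d1 d2 in auto)
  qed simp
qed

text \<open>A bootstrap: injectivity of \<open>A x\<close> bounds \<open>X y - X x\<close> by the
  residual \<open>F y - A y (X x)\<close>, so \<open>X\<close> is continuous; continuity makes
  \<open>(A y - A x) (X y - X x)\<close> negligible, and a system with constant coefficients
  \<open>A x\<close> remains.\<close>

lemma linear_system_solution_has_derivative:
  fixes A :: "'a::real_normed_vector \<Rightarrow> 'b::euclidean_space \<Rightarrow> 'c::euclidean_space"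
  assumes lin: "\<forall>\<^sub>F y in nhds x. linear (A y)" and inj: "inj (A x)"
    and A: "\<And>v. ((\<lambda>y. A y v) has_derivative (\<lambda>w. A' w v)) (at x)"
    and F: "(F has_derivative F') (at x)"
    and X: "\<forall>\<^sub>F y in nhds x. A y (X y) = F y"
  shows "\<exists>X'. (X has_derivative X') (at x)"
proof -
  have linx: "linear (A x)" and Xx: "A x (X x) = F x"
    using lin X by (auto dest: eventually_nhds_x_imp_x)
  obtain c where c: "c > 0" "\<And>v. c * norm v \<le> norm (A x v)"
    using linear_inj_bounded_below_pos[OF linx inj] by blast
  obtain B where B: "linear B" "B \<circ> A x = id"
    using linear_injective_left_inverse[OF linx inj] by blast
  have bB: "bounded_linear B"
    using B(1) linear_conv_bounded_linear by blast
  have diff: "A y v - A x v = (\<Sum>b\<in>Basis. (v \<bullet> b) *\<^sub>R (A y b - A x b))" if "linear (A y)" for y v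
    unfolding linear_Basis_expansion[OF that, of v] linear_Basis_expansion[OF linx, of v]
    by (simp add: scaleR_diff_right sum_subtractf)
  \<comment> \<open>Below, one error of \<open>c / (2 * m)\<close> per basis vector adds up to
    \<open>c / 2\<close>, so \<open>A y\<close> keeps half of the lower bound \<open>c\<close> of
    \<open>A x\<close>.\<close>
  define m where "m = real DIM('b)"
  have m: "m > 0" by (simp add: m_def)
  have "\<forall>\<^sub>F y in nhds x. \<forall>b\<in>Basis. norm (A y b - A x b) < c / (2 * m)"
  proof (intro eventually_ball_finite ballI)
    fix b :: 'b
    have "((\<lambda>y. A y b) \<longlongrightarrow> A x b) (nhds x)"
      using has_derivative_continuous[OF A[of b]]
      by (metis continuous_within tendsto_at_iff_tendsto_nhds)
    then show "\<forall>\<^sub>F y in nhds x. norm (A y b - A x b) < c / (2 * m)"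
      using tendstoD[of "\<lambda>y. A y b" "A x b" "nhds x" "c / (2 * m)"] c(1) m by (simp add: dist_norm)
  qed simp
  with lin X have bound: "\<forall>\<^sub>F y in nhds x. norm (X y - X x) \<le> 2 / c * norm (F y - A y (X x))"
  proof eventually_elim
    case (elim y)
    define D where "D = X y - X x"
    have "A y D - A x D = (\<Sum>b\<in>Basis. (D \<bullet> b) *\<^sub>R (A y b - A x b))"
      by (rule diff[OF elim(1)])
    also have "norm \<dots> \<le> (\<Sum>b\<in>(Basis :: 'b set). norm D * (c / (2 * m)))"
    proof (rule sum_norm_le)
      fix b :: 'b assume "b \<in> Basis"
      then show "norm ((D \<bullet> b) *\<^sub>R (A y b - A x b)) \<le> norm D * (c / (2 * m))"
        unfolding norm_scaleR using elim(3) by (intro mult_mono) (auto simp: Basis_le_norm less_imp_le)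
    qed
    also have "\<dots> = c / 2 * norm D"
      using m by (simp add: m_def[symmetric])
    finally have "norm (A x D) - norm (A y D) \<le> c / 2 * norm D"
      using norm_triangle_ineq2[of "A x D" "A y D"] by (simp add: norm_minus_commute)
    then have "c / 2 * norm D \<le> norm (A y D)"
      using c(2)[of D] by linarith
    also have "A y D = F y - A y (X x)"
      using elim by (simp add: D_def linear_diff)
    finally show ?case
      using c(1) by (simp add: D_def field_simps)
  qed
  have FA: "((\<lambda>y. F y - A y (X x)) has_derivative (\<lambda>w. F' w - A' w (X x))) (at x)"
    by (intro has_derivative_diff F A)
  have FA0: "((\<lambda>y. F y - A y (X x)) \<longlongrightarrow> 0) (at x)"
    using has_derivative_continuous[OF FA] Xx by (simp add: continuous_within)
  have "((\<lambda>y. 2 / c * norm (F y - A y (X x))) \<longlongrightarrow> 0) (at x)"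
    by (intro tendsto_mult_right_zero tendsto_norm_zero FA0)
  then have "((\<lambda>y. X y - X x) \<longlongrightarrow> 0) (at x)"
    by (rule Lim_null_comparison[rotated])
      (use bound in \<open>auto simp: eventually_at_filter elim: eventually_mono\<close>)
  then have cont: "isCont X x"
    by (simp add: isCont_def LIM_zero_iff)
  \<comment> \<open>The negligible term, expanded so that each summand is a continuous vanishing
    factor times a differentiable vanishing one.\<close>
  define R where "R = (\<lambda>y. \<Sum>b\<in>Basis. ((X y - X x) \<bullet> b) *\<^sub>R (A y b - A x b))"
  have "((\<lambda>y. ((X y - X x) \<bullet> b) *\<^sub>R (A y b - A x b)) has_derivative (\<lambda>_. 0)) (at x)" for b
  proof (rule has_derivative_scaleR_vanishing)
    show "((\<lambda>y. A y b - A x b) has_derivative (\<lambda>w. A' w b)) (at x)"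
      using A[of b] by (auto intro!: derivative_eq_intros)
  qed (auto intro!: continuous_intros cont)
  then have "(R has_derivative (\<lambda>_. \<Sum>b\<in>(Basis :: 'b set). 0)) (at x)"
    unfolding R_def by (intro has_derivative_sum) simp
  from has_derivative_diff[OF FA this]
  have "((\<lambda>y. X x + B (F y - A y (X x) - R y)) has_derivative
      (\<lambda>w. B (F' w - A' w (X x)))) (at x)"
    using has_derivative_add[OF has_derivative_const bounded_linear.has_derivative[OF bB]]
    by fastforce
  moreover have eq: "\<forall>\<^sub>F y in nhds x. X x + B (F y - A y (X x) - R y) = X y"
    using lin X
  proof eventually_elim
    case (elim y)
    have "R y = A y (X y - X x) - A x (X y - X x)"
      by (simp add: R_def diff elim(1))
    then have "F y - A y (X x) - R y = A x (X y - X x)"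
      using elim by (simp add: linear_diff)
    then show ?case
      using B(2) by (simp add: o_def fun_eq_iff)
  qed
  ultimately have "(X has_derivative (\<lambda>w. B (F' w - A' w (X x)))) (at x)"
    by (rule has_derivative_transform_nhds)
  then show ?thesis by blast
qed

lemma grad_inner:
  assumes "inner_form (g x)" "(f has_derivative f') (at x)"
  shows "g x (grad g f x) w = f' w"
proof -
  have f': "f' = frechet_derivative f (at x)"
    using frechet_derivative_at[OF assms(2)] .
  have "\<exists>!v. \<forall>w. g x v w = frechet_derivative f (at x) w"
    using inner_form_represents[OF assms(1)] has_derivative_linear[OF assms(2)] unfolding f' .
  from theI'[OF this] show ?thesis
    unfolding grad_def f' by blast
qed

text \<open>Parseval's identity: the coefficients of a gradient in an orthonormal frame are the
  derivatives along the frame vectors.\<close>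

lemma grad_inner_grad:
  assumes g: "inner_form (g x)" and e: "orthonormal_frame (g x) I e"
    and "(f has_derivative f') (at x)" "(k has_derivative k') (at x)"
  shows "g x (grad g f x) (grad g k x) = (\<Sum>i\<in>I. f' (e i) * k' (e i))"
proof -
  have "g x (grad g f x) (grad g k x) = f' (\<Sum>i\<in>I. k' (e i) *\<^sub>R e i)"
    using orthonormal_frame_expansion[OF g e, of "grad g k x"]
    by (simp add: grad_inner[of g, OF g assms(3)] grad_inner[of g, OF g assms(4)])
  then show ?thesis
    using has_derivative_linear[OF assms(3)] by (simp add: linear_sum linear_scale mult.commute)
qed

text \<open>\<open>cov_deriv\<close> differentiates the gradient, which \<open>THE\<close> defines
  point by point. The gradient solves the linear system with the metric tensor as matrix and the
  differential of \<open>f\<close> as right-hand side.\<close>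

lemma grad_has_derivative:
  fixes g :: "'e::euclidean_space \<Rightarrow> 'e \<Rightarrow> 'e \<Rightarrow> real"
  assumes g: "\<forall>\<^sub>F y in nhds x. inner_form (g y)"
    and g': "\<And>v w. ((\<lambda>y. g y v w) has_derivative (\<lambda>u. g' u v w)) (at x)"
    and f: "has_second_derivative f f' f'' x"
  shows "\<exists>X'. (grad g f has_derivative X') (at x)"
proof (rule linear_system_solution_has_derivative)
  let ?A = "\<lambda>y v. \<Sum>b\<in>Basis. g y v b *\<^sub>R b"
  show "\<forall>\<^sub>F y in nhds x. linear (?A y)"
    using g
  proof eventually_elim
    case (elim y)
    then show ?case
      by (intro linearI) (simp_all add: linear_add[OF inner_form_linear(2)]
          linear_scale[OF inner_form_linear(2)] scaleR_add_left sum.distrib scaleR_sum_right)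
  qed
  show "inj (?A x)"
  proof (rule injI)
    fix u v assume uv: "?A x u = ?A x v"
    have G: "inner_form (g x)" using eventually_nhds_x_imp_x[OF g] .
    have "?A x u \<bullet> w = g x u w" for u w
      by (rule inner_Basis_sum[OF inner_form_linear(1)[OF G]])
    with uv show "u = v"
      using inner_form_eqI[OF G] by metis
  qed
  show "((\<lambda>y. ?A y v) has_derivative (\<lambda>u. \<Sum>b\<in>Basis. g' u v b *\<^sub>R b)) (at x)" for v
    by (auto intro!: derivative_eq_intros g')
  show "((\<lambda>y. \<Sum>b\<in>Basis. f' y b *\<^sub>R b) has_derivative (\<lambda>u. \<Sum>b\<in>Basis. f'' u b *\<^sub>R b)) (at x)"
    by (auto intro!: derivative_eq_intros has_second_derivativeD(2)[OF f])
  have "\<forall>\<^sub>F y in nhds x. (f has_derivative f' y) (at y)"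
    using f by (simp add: has_second_derivative_def)
  with g show "\<forall>\<^sub>F y in nhds x. ?A y (grad g f y) = (\<Sum>b\<in>Basis. f' y b *\<^sub>R b)"
    by eventually_elim (simp add: grad_inner)
qed

lemma christoffel_inner:
  fixes g :: "'e::euclidean_space \<Rightarrow> 'e \<Rightarrow> 'e \<Rightarrow> real"
  assumes G: "inner_form (g x)"
    and g': "\<And>v w. ((\<lambda>y. g y v w) has_derivative (\<lambda>u. g' u v w)) (at x)"
    and lin: "\<And>u v. linear (g' u v)"
  shows "2 * g x (christoffel g x v w) u = g' v w u + g' w v u - g' u v w"
proof -
  have fd: "frechet_derivative (\<lambda>y. g y v w) (at x) u = g' u v w" for u v w
    using frechet_derivative_at[OF g'] by metis
  have "linear (\<lambda>u. (1/2) *\<^sub>R (g' v w u + g' w v u - g' u v w))"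
    by (intro linear_compose_scale_right linear_compose_sub linear_compose_add lin
        has_derivative_linear[OF g'])
  from inner_form_represents[OF G this]
  have "\<exists>!c. \<forall>u. 2 * g x c u = g' v w u + g' w v u - g' u v w"
    by (simp add: field_simps)
  from theI'[OF this] show ?thesis
    unfolding christoffel_def fd by blast
qed

text \<open>The subtracted term is the differential of \<open>f\<close> on
  \<open>\<Gamma>(e i, e i)\<close>, written as a pairing with the gradient, so each summand is the
  covariant Hessian on a frame vector. The frame lives at the point \<open>x\<close> alone.\<close>

lemma laplacian_orthonormal_frame:
  fixes g :: "'e::euclidean_space \<Rightarrow> 'e \<Rightarrow> 'e \<Rightarrow> real"
  assumes g: "\<forall>\<^sub>F y in nhds x. inner_form (g y)"
    and g': "\<And>v w. ((\<lambda>y. g y v w) has_derivative (\<lambda>u. g' u v w)) (at x)"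
    and f: "has_second_derivative f f' f'' x"
    and e: "orthonormal_frame (g x) I e"
  shows "laplacian g f x = (\<Sum>i\<in>I. f'' (e i) (e i)
    - (g' (e i) (e i) (grad g f x) - g' (grad g f x) (e i) (e i) / 2))"
proof -
  have G: "inner_form (g x)" using eventually_nhds_x_imp_x[OF g] .
  let ?X = "grad g f x"
  \<comment> \<open>\<open>g'\<close> is given only as a family of derivatives; symmetry and
    linearity in the metric slots pass to it from \<open>g\<close> by uniqueness of
    derivatives.\<close>
  have sym: "g' u v w = g' u w v" for u v w
  proof -
    have eq: "\<forall>\<^sub>F y in nhds x. g y v w = g y w v"
      using g by eventually_elim (rule inner_form_sym)
    have "((\<lambda>y. g y w v) has_derivative (\<lambda>u. g' u v w)) (at x)"
      using g' eq by (rule has_derivative_transform_nhds)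
    then show ?thesis
      using has_derivative_unique[OF _ g'] by (metis (no_types))
  qed
  have lin: "linear (g' u v)" for u v
  proof (rule linearI)
    fix w z :: 'e and r :: real
    have "((\<lambda>y. g y v w + g y v z) has_derivative (\<lambda>u. g' u v (w + z))) (at x)"
    proof (rule has_derivative_transform_nhds[OF g'])
      show "\<forall>\<^sub>F y in nhds x. g y v (w + z) = g y v w + g y v z"
        using g by eventually_elim (rule linear_add[OF inner_form_linear(1)])
    qed
    from has_derivative_unique[OF this has_derivative_add[OF g' g']]
    show "g' u v (w + z) = g' u v w + g' u v z" by (rule fun_cong)
    have "((\<lambda>y. r *\<^sub>R g y v w) has_derivative (\<lambda>u. g' u v (r *\<^sub>R w))) (at x)"
    proof (rule has_derivative_transform_nhds[OF g'])
      show "\<forall>\<^sub>F y in nhds x. g y v (r *\<^sub>R w) = r *\<^sub>R g y v w"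
        using g by eventually_elim (rule linear_scale[OF inner_form_linear(1)])
    qed
    from has_derivative_unique[OF this has_derivative_scaleR_right[OF g']]
    show "g' u v (r *\<^sub>R w) = r *\<^sub>R g' u v w" by (rule fun_cong)
  qed
  note Gam = christoffel_inner[of g x g', OF G g' lin]
  obtain X' where X': "(grad g f has_derivative X') (at x)"
    using grad_has_derivative[OF g g' f] by blast
  have cov: "cov_deriv g v (grad g f) x = X' v + christoffel g x v ?X" for v
    using frechet_derivative_at[OF X'] by (simp add: cov_deriv_def)
  have lin_cov: "linear (\<lambda>v. cov_deriv g v (grad g f) x)"
  proof -
    have "linear (\<lambda>v. christoffel g x v ?X)"
    proof (rule linearI; rule inner_form_eqI[OF G])
      fix v w u and r :: real
      note simps = linear_add[OF inner_form_linear(2)[OF G]] linear_scale[OF inner_form_linear(2)[OF G]]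
        linear_add[OF lin] linear_scale[OF lin]
        linear_add[OF has_derivative_linear[OF g']] linear_scale[OF has_derivative_linear[OF g']]
      have "2 * g x (christoffel g x (v + w) ?X) u =
          2 * g x (christoffel g x v ?X) u + 2 * g x (christoffel g x w ?X) u"
        unfolding Gam using sym[of ?X _ u] sym[of u _ ?X] by (simp add: simps)
      then show "g x (christoffel g x (v + w) ?X) u = g x (christoffel g x v ?X + christoffel g x w ?X) u"
        by (simp add: simps)
      have "2 * g x (christoffel g x (r *\<^sub>R v) ?X) u = r * (2 * g x (christoffel g x v ?X) u)"
        unfolding Gam using sym[of ?X _ u] sym[of u _ ?X] by (simp add: simps algebra_simps)
      then show "g x (christoffel g x (r *\<^sub>R v) ?X) u = g x (r *\<^sub>R christoffel g x v ?X) u"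
        by (simp add: simps)
    qed
    then show ?thesis
      unfolding cov using has_derivative_linear[OF X'] by (intro linear_compose_add)
  qed
  \<comment> \<open>Differentiating the defining equation of the gradient expresses its unknown
    derivative \<open>X'\<close> by \<open>f''\<close> and \<open>g'\<close>.\<close>
  have DX: "g x (X' v) w = f'' v w - g' v ?X w" for v w
  proof -
    have "\<forall>\<^sub>F y in nhds x. (f has_derivative f' y) (at y)"
      using f by (simp add: has_second_derivative_def)
    with g have eq: "\<forall>\<^sub>F y in nhds x. g y (grad g f y) w = f' y w"
      by eventually_elim (rule grad_inner)
    have "((\<lambda>y. g y (grad g f y) w) has_derivative (\<lambda>v. g' v ?X w + g x (X' v) w)) (at x)"
      using g by (intro has_derivative_apply[where A = "\<lambda>y v. g y v w" and A' = "\<lambda>u v. g' u v w"] g' X')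
        (auto intro: inner_form_linear(2) elim: eventually_mono)
    then have "((\<lambda>y. f' y w) has_derivative (\<lambda>v. g' v ?X w + g x (X' v) w)) (at x)"
      using eq by (rule has_derivative_transform_nhds)
    from has_derivative_unique[OF this has_second_derivativeD(2)[OF f]]
    have "g' v ?X w + g x (X' v) w = f'' v w" by (rule fun_cong)
    then show ?thesis by simp
  qed
  have "laplacian g f x = (\<Sum>i\<in>I. g x (cov_deriv g (e i) (grad g f) x) (e i))"
    unfolding laplacian_def divergence_def by (rule trace_orthonormal_frame[OF G e lin_cov])
  also have "\<dots> = (\<Sum>i\<in>I. f'' (e i) (e i) - (g' (e i) (e i) ?X - g' ?X (e i) (e i) / 2))"
  proof (rule sum.cong[OF refl])
    fix i
    \<comment> \<open>The first and third Koszul terms cancel by symmetry; the derivative along the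
      gradient remains.\<close>
    have "2 * g x (christoffel g x (e i) ?X) (e i) = g' ?X (e i) (e i)"
      unfolding Gam using sym by simp
    then show "g x (cov_deriv g (e i) (grad g f) x) (e i) =
        f'' (e i) (e i) - (g' (e i) (e i) ?X - g' ?X (e i) (e i) / 2)"
      using sym[of "e i" ?X "e i"]
      by (simp add: cov linear_add[OF inner_form_linear(2)[OF G]] DX)
  qed
  finally show ?thesis .
qed


section \<open>Hermitian algebra over the scalars\<close>

text \<open>Reflection fixing the real line: the identity on \<open>real\<close>, the usual
  conjugation on \<open>complex\<close> and \<open>quat\<close>. It is built from the inner product
  because the type classes provide no conjugation.\<close>

definition conjugate :: "'k::{real_normed_div_algebra, euclidean_space} \<Rightarrow> 'k"
  where "conjugate a = (2 * (a \<bullet> 1)) *\<^sub>R 1 - a"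

text \<open>The conjugate stands on the left because scalars act from the right, so that
  \<open>hermitian z\<close> is linear over right scalars.\<close>

definition hermitian :: "'k::{real_normed_div_algebra, euclidean_space} ^ 'n \<Rightarrow> 'k ^ 'n \<Rightarrow> 'k"
  where "hermitian z v = (\<Sum>k\<in>UNIV. conjugate (z $ k) * v $ k)"

definition rscale :: "'k::{real_normed_div_algebra, euclidean_space} ^ 'n \<Rightarrow> 'k \<Rightarrow> 'k ^ 'n"
  where "rscale z c = (\<chi> k. z $ k * c)"

context
  fixes a b x y :: "'k::{real_normed_div_algebra, euclidean_space}"
begin

lemma inner_one_one: "(1 :: 'k) \<bullet> 1 = 1"
  by (simp add: dot_square_norm)

lemma inner_mult_same_left: "(a * x) \<bullet> (a * y) = (norm a)\<^sup>2 * (x \<bullet> y)"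
  unfolding dot_norm distrib_left[symmetric] norm_mult power_mult_distrib
  by (simp add: algebra_simps)

lemma inner_mult_same_right: "(x * a) \<bullet> (y * a) = (norm a)\<^sup>2 * (x \<bullet> y)"
  unfolding dot_norm distrib_right[symmetric] norm_mult power_mult_distrib
  by (simp add: algebra_simps)

end

text \<open>Polarize \<open>\<langle>a x, a y\<rangle> = |a|\<^sup>2 \<langle>x, y\<rangle>\<close> in \<open>a\<close>.\<close>

lemma inner_mult_left_adjoint:
  fixes a x y :: "'k::{real_normed_div_algebra, euclidean_space}"
  shows "(a * x) \<bullet> y = x \<bullet> (conjugate a * y)"
proof -
  have "((a + 1) * x) \<bullet> ((a + 1) * y) = (norm (a + 1))\<^sup>2 * (x \<bullet> y)"
    by (rule inner_mult_same_left)
  moreover have "(norm (a + 1))\<^sup>2 = (norm a)\<^sup>2 + 2 * (a \<bullet> 1) + 1"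
    using dot_norm[of a 1] by simp
  ultimately show ?thesis
    using inner_mult_same_left[of a x y]
    by (simp add: conjugate_def algebra_simps inner_add_left inner_add_right inner_diff_right)
qed

text \<open>Left multiplication by \<open>a\<close> has adjoint \<open>conjugate a\<close> and is a
  similarity with factor \<open>norm a\<close>; the two facts are compared on the vector 1.\<close>

lemma conjugate_mult_self: "conjugate a * a = (norm a)\<^sup>2 *\<^sub>R 1"
  for a :: "'k::{real_normed_div_algebra, euclidean_space}"
proof -
  have "x \<bullet> (conjugate a * a) = x \<bullet> ((norm a)\<^sup>2 *\<^sub>R 1)" for x
    using inner_mult_left_adjoint[of a x a] inner_mult_same_left[of a x 1] by simp
  then show ?thesis
    using vector_eq_ldot by blast
qed

text \<open>The quadratic equation of a scalar. It eliminates the square of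
  \<open>hermitian w v\<close> in \<open>fubini_study_christoffel\<close>.\<close>

lemma square_eq_conjugate: "a * a = (2 * (a \<bullet> 1)) *\<^sub>R a - (a \<bullet> a) *\<^sub>R 1"
  for a :: "'k::{real_normed_div_algebra, euclidean_space}"
  using conjugate_mult_self[of a]
  by (simp add: conjugate_def algebra_simps power2_norm_eq_inner)

text \<open>Adjoints compose in the reverse order.\<close>

lemma conjugate_mult: "conjugate (a * b) = conjugate b * conjugate a"
  for a b :: "'k::{real_normed_div_algebra, euclidean_space}"
proof -
  have "x \<bullet> conjugate (a * b) = x \<bullet> (conjugate b * conjugate a)" for x
    using inner_mult_left_adjoint[of "a * b" x 1] inner_mult_left_adjoint[of b x "conjugate a"]
      inner_mult_left_adjoint[of a "b * x" 1] by (simp add: mult.assoc)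
  then show ?thesis
    using vector_eq_ldot by blast
qed

lemma conjugate_conjugate [simp]: "conjugate (conjugate a) = a"
  by (simp add: conjugate_def inner_diff_left inner_one_one)

lemma conjugate_one [simp]: "conjugate 1 = 1"
  by (simp add: conjugate_def inner_one_one scaleR_2)

lemma linear_conjugate: "linear conjugate"
  by (rule linearI) (simp_all add: conjugate_def inner_add_left algebra_simps)

lemma inner_conjugate: "conjugate a \<bullet> b = 2 * (a \<bullet> 1) * (1 \<bullet> b) - a \<bullet> b"
  by (simp add: conjugate_def inner_diff_left)

section \<open>The Hermitian product and right scaling\<close>

lemma bilinear_hermitian: "bilinear hermitian"
  unfolding bilinear_def hermitian_def
  by (auto intro!: linearI simp: linear_add[OF linear_conjugate] linear_scale[OF linear_conjugate]
      algebra_simps sum.distrib scaleR_sum_right)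

lemma bounded_bilinear_hermitian: "bounded_bilinear hermitian"
  using bilinear_hermitian by (simp add: bilinear_conv_bounded_bilinear)

lemma bounded_bilinear_rscale: "bounded_bilinear rscale"
proof -
  have "bilinear rscale"
    unfolding bilinear_def rscale_def
    by (auto intro!: linearI simp: vec_eq_iff algebra_simps)
  then show ?thesis by (simp add: bilinear_conv_bounded_bilinear)
qed

lemmas hermitian_simps =
  bounded_bilinear.add_left[OF bounded_bilinear_hermitian]
  bounded_bilinear.add_right[OF bounded_bilinear_hermitian]
  bounded_bilinear.diff_left[OF bounded_bilinear_hermitian]
  bounded_bilinear.diff_right[OF bounded_bilinear_hermitian]
  bounded_bilinear.scaleR_left[OF bounded_bilinear_hermitian]
  bounded_bilinear.scaleR_right[OF bounded_bilinear_hermitian]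
  bounded_bilinear.minus_left[OF bounded_bilinear_hermitian]
  bounded_bilinear.minus_right[OF bounded_bilinear_hermitian]
  bounded_bilinear.zero_left[OF bounded_bilinear_hermitian]
  bounded_bilinear.zero_right[OF bounded_bilinear_hermitian]

lemmas rscale_simps =
  bounded_bilinear.add_left[OF bounded_bilinear_rscale]
  bounded_bilinear.add_right[OF bounded_bilinear_rscale]
  bounded_bilinear.diff_left[OF bounded_bilinear_rscale]
  bounded_bilinear.diff_right[OF bounded_bilinear_rscale]
  bounded_bilinear.scaleR_left[OF bounded_bilinear_rscale]
  bounded_bilinear.scaleR_right[OF bounded_bilinear_rscale]
  bounded_bilinear.minus_left[OF bounded_bilinear_rscale]
  bounded_bilinear.minus_right[OF bounded_bilinear_rscale]
  bounded_bilinear.zero_left[OF bounded_bilinear_rscale]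
  bounded_bilinear.zero_right[OF bounded_bilinear_rscale]

lemma rscale_rscale: "rscale (rscale z a) b = rscale z (a * b)"
  by (simp add: rscale_def vec_eq_iff mult.assoc)

lemma rscale_one [simp]: "rscale z 1 = z"
  by (simp add: rscale_def vec_eq_iff)

lemma rscale_nth [simp]: "rscale z c $ k = z $ k * c"
  by (simp add: rscale_def)

text \<open>One scalar \<open>hermitian z v\<close> contains the real inner products of
  \<open>v\<close> with all \<open>z c\<close>; orthogonality to the whole scalar line through
  \<open>z\<close> becomes the equation \<open>hermitian z v = 0\<close>.\<close>

lemma inner_rscale_left: "rscale z c \<bullet> v = c \<bullet> hermitian z v"
  by (simp add: inner_vec_def hermitian_def inner_sum_right inner_mult_left_adjoint)

lemma inner_rscale_right: "v \<bullet> rscale z c = hermitian z v \<bullet> c"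
  by (metis inner_commute inner_rscale_left)

lemma inner_eq_inner_hermitian: "z \<bullet> v = 1 \<bullet> hermitian z v"
  using inner_rscale_left[of z 1 v] by simp

lemma hermitian_rscale_right: "hermitian z (rscale v c) = hermitian z v * c"
  by (simp add: hermitian_def sum_distrib_right mult.assoc)

lemma hermitian_rscale_left: "hermitian (rscale z c) v = conjugate c * hermitian z v"
  by (simp add: hermitian_def conjugate_mult sum_distrib_left mult.assoc)

lemma hermitian_self: "hermitian z z = (z \<bullet> z) *\<^sub>R 1"
  by (simp add: hermitian_def conjugate_mult_self inner_vec_def scaleR_sum_left
      power2_norm_eq_inner)

lemma conjugate_hermitian: "conjugate (hermitian z v) = hermitian v z"
  by (simp add: hermitian_def linear_sum[OF linear_conjugate] conjugate_mult)

lemma inner_rscale_rscale: "rscale z c \<bullet> rscale v c = (norm c)\<^sup>2 * (z \<bullet> v)"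
  by (simp add: inner_vec_def inner_mult_same_right sum_distrib_left)

lemma norm_rscale: "norm (rscale z c) = norm z * norm c"
  by (rule power2_eq_imp_eq)
    (simp_all add: power2_norm_eq_inner inner_rscale_rscale power_mult_distrib)


section \<open>The Fubini--Study metric in an affine chart\<close>

text \<open>The inner product of horizontal lifts, see \<open>inner_lift\<close>; the second term
  removes the part along the scalar line. For real scalars this is the round metric in central
  projection.\<close>

definition fubini_study ::
    "'k::{real_normed_div_algebra, euclidean_space} ^ 'm \<Rightarrow> 'k ^ 'm \<Rightarrow> 'k ^ 'm \<Rightarrow> real"
  where "fubini_study w v u =
    (v \<bullet> u) / (1 + w \<bullet> w) - (hermitian w v \<bullet> hermitian w u) / (1 + w \<bullet> w)\<^sup>2"

definition fubini_study_deriv ::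
    "'k::{real_normed_div_algebra, euclidean_space} ^ 'm \<Rightarrow> 'k ^ 'm \<Rightarrow> 'k ^ 'm \<Rightarrow> 'k ^ 'm \<Rightarrow> real"
  where "fubini_study_deriv w d v u =
    4 * (w \<bullet> d) * (hermitian w v \<bullet> hermitian w u) / (1 + w \<bullet> w) ^ 3
    - (2 * (w \<bullet> d) * (v \<bullet> u) + hermitian d v \<bullet> hermitian w u + hermitian w v \<bullet> hermitian d u)
      / (1 + w \<bullet> w)\<^sup>2"

lemma one_plus_inner_ne_0: "1 + w \<bullet> w \<noteq> 0" for w :: "'a::real_inner"
  using inner_ge_zero[of w] by linarith

lemma fubini_study_has_derivative:
  "((\<lambda>y. fubini_study y v u) has_derivative (\<lambda>d. fubini_study_deriv w d v u)) (at w)"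
proof -
  have N: "1 + w \<bullet> w \<noteq> 0"
    by (rule one_plus_inner_ne_0)
  have h: "((\<lambda>y. hermitian y x) has_derivative (\<lambda>d. hermitian d x)) (at w)" for x :: "'a ^ 'b"
    by (rule bounded_linear_imp_has_derivative
        [OF bounded_bilinear.bounded_linear_left[OF bounded_bilinear_hermitian]])
  define P where "P = (\<lambda>y :: 'a ^ 'b. 1 + y \<bullet> y)"
  define H where "H = (\<lambda>y. hermitian y v \<bullet> hermitian y u)"
  have P: "(P has_derivative (\<lambda>d. 2 * (w \<bullet> d))) (at w)"
    unfolding P_def by (auto intro!: derivative_eq_intros simp: inner_commute)
  have H: "(H has_derivative (\<lambda>d. hermitian w v \<bullet> hermitian d u + hermitian d v \<bullet> hermitian w u)) (at w)"
    unfolding H_def by (rule has_derivative_inner[OF h h])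
  have Pw: "P w \<noteq> 0" using N by (simp add: P_def)
  have "((\<lambda>y. (v \<bullet> u) * inverse (P y) - H y * (inverse (P y))\<^sup>2) has_derivative
      (\<lambda>d. 4 * (w \<bullet> d) * H w * inverse (P w) ^ 3
        - (2 * (w \<bullet> d) * (v \<bullet> u) + hermitian d v \<bullet> hermitian w u + hermitian w v \<bullet> hermitian d u)
          * (inverse (P w))\<^sup>2)) (at w)"
    by (rule derivative_eq_intros P H Pw refl)+
      (simp add: fun_eq_iff power2_eq_square power3_eq_cube algebra_simps)
  then show ?thesis
    by (simp add: fubini_study_def[abs_def] fubini_study_deriv_def P_def H_def divide_inverse
        power_inverse)
qed

text \<open>
  The left hand side is \<open>\<langle>\<Gamma>(v, v), u\<rangle>\<close>. The vector \<open>(2 / (1 + |w|\<^sup>2)) v (w\<^sup>* v)\<close> on the right is the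
  second derivative of the affine chart in the direction of the horizontal lift of \<open>v\<close>; see
  \<open>d2affine_lift\<close>.
\<close>

lemma fubini_study_christoffel:
  "fubini_study_deriv w v v u - fubini_study_deriv w u v v / 2 =
    - fubini_study w ((2 / (1 + w \<bullet> w)) *\<^sub>R rscale v (hermitian w v)) u"
proof -
  define N where "N = 1 + w \<bullet> w"
  have N: "N \<noteq> 0"
    unfolding N_def by (rule one_plus_inner_ne_0)
  \<comment> \<open>Every pairing reduces to real inner products among \<open>k\<close>,
    \<open>t\<close>, \<open>s\<close> and 1: \<open>square_eq_conjugate\<close> removes the square
    of \<open>k\<close>, and \<open>hermitian u v\<close> is the conjugate of \<open>s\<close>. What
    remains is an identity of rational functions.\<close>
  define k where "k = hermitian w v"
  define t where "t = hermitian w u"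
  define s where "s = hermitian v u"
  have 1: "w \<bullet> v = 1 \<bullet> k" "w \<bullet> u = 1 \<bullet> t" "v \<bullet> u = 1 \<bullet> s"
    by (simp_all add: k_def t_def s_def inner_eq_inner_hermitian)
  have 2: "rscale v k \<bullet> u = k \<bullet> s"
    by (simp add: s_def inner_rscale_left)
  have 3: "hermitian w (rscale v k) \<bullet> t = 2 * (1 \<bullet> k) * (k \<bullet> t) - (k \<bullet> k) * (1 \<bullet> t)"
  proof -
    have "hermitian w (rscale v k) = (2 * (1 \<bullet> k)) *\<^sub>R k - (k \<bullet> k) *\<^sub>R 1"
      using square_eq_conjugate[of k] inner_commute[of k 1]
      by (simp add: hermitian_rscale_right flip: k_def)
    then show ?thesis
      by (simp add: inner_diff_left)
  qed
  have 4: "hermitian v v \<bullet> t = (v \<bullet> v) * (1 \<bullet> t)"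
    by (simp add: hermitian_self)
  have 5: "hermitian u v \<bullet> k = 2 * (1 \<bullet> s) * (1 \<bullet> k) - k \<bullet> s"
    using inner_conjugate[of s k] inner_commute[of s 1] inner_commute[of s k]
    by (simp add: s_def conjugate_hermitian)
  have 6: "k \<bullet> hermitian u v = 2 * (1 \<bullet> s) * (1 \<bullet> k) - k \<bullet> s"
    using 5 inner_commute[of k "hermitian u v"] by simp
  show ?thesis
    unfolding fubini_study_def fubini_study_deriv_def hermitian_simps inner_scaleR_left
      N_def[symmetric] k_def[symmetric] t_def[symmetric] s_def[symmetric] 1 2 3 4 5 6
    using N by (simp add: divide_simps) algebra
qed


section \<open>Affine charts\<close>

locale affine_chart =
  fixes e :: "'m::finite \<Rightarrow> 'm option"
  assumes inj_e: "inj e"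
begin

definition pole :: "'m option"
  where "pole = (SOME i. i \<notin> range e)"

lemma pole_notin: "pole \<notin> range e"
proof -
  have "range e \<noteq> UNIV"
    using card_image[OF inj_e] by (metis card_option n_not_Suc_n)
  then show ?thesis
    unfolding pole_def by (metis UNIV_eq_I someI)
qed

lemma UNIV_eq: "UNIV = insert pole (range e)"
proof (rule sym, rule card_subset_eq)
  show "card (insert pole (range e)) = card (UNIV :: 'm option set)"
    using pole_notin card_image[OF inj_e] by simp
qed auto

lemma sum_eq: "(\<Sum>k\<in>UNIV. f k) = f pole + (\<Sum>j\<in>UNIV. f (e j))"
  for f :: "'m option \<Rightarrow> 'b::comm_monoid_add"
  unfolding UNIV_eq using pole_notin by (simp add: sum.reindex[OF inj_e])

definition join :: "'k::{real_normed_div_algebra, euclidean_space} ^ 'm \<Rightarrow> 'k \<Rightarrow> 'k ^ 'm option"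
  where "join w c = (\<chi> i. if i \<in> range e then w $ inv e i else c)"

definition rest :: "'k::{real_normed_div_algebra, euclidean_space} ^ 'm option \<Rightarrow> 'k ^ 'm"
  where "rest z = (\<chi> j. z $ e j)"

definition affine_coords :: "'k::{real_normed_div_algebra, euclidean_space} ^ 'm option \<Rightarrow> 'k ^ 'm"
  where "affine_coords z = rscale (rest z) (inverse (z $ pole))"

definition daffine ::
    "'k::{real_normed_div_algebra, euclidean_space} ^ 'm option \<Rightarrow> 'k ^ 'm option \<Rightarrow> 'k ^ 'm"
  where "daffine z v = rscale (rest v - rscale (affine_coords z) (v $ pole)) (inverse (z $ pole))"

definition d2affine ::
    "'k::{real_normed_div_algebra, euclidean_space} ^ 'm option \<Rightarrow> 'k ^ 'm option \<Rightarrow>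
     'k ^ 'm option \<Rightarrow> 'k ^ 'm"
  where "d2affine z u v =
    - rscale (daffine z u) (v $ pole * inverse (z $ pole))
    - rscale (daffine z v) (u $ pole * inverse (z $ pole))"

text \<open>The horizontal lift to \<open>z\<close> of a tangent vector \<open>v\<close> at \<open>affine_coords z\<close>.\<close>

definition lift ::
    "'k::{real_normed_div_algebra, euclidean_space} ^ 'm option \<Rightarrow> 'k ^ 'm \<Rightarrow> 'k ^ 'm option"
  where "lift z v = (let w = affine_coords z; k = - hermitian w v /\<^sub>R (1 + w \<bullet> w) in
    rscale (join (v + rscale w k) k) (z $ pole))"

text \<open>A section of the quotient map over the whole chart. It provides a point of the sphere
  over each \<open>w\<close> and carries smoothness down to the projective space.\<close>

definition section_map :: "'k::{real_normed_div_algebra, euclidean_space} ^ 'm \<Rightarrow> 'k ^ 'm option"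
  where "section_map w = join w 1 /\<^sub>R norm (join w 1)"

section \<open>Splitting off the pole coordinate\<close>

lemma vec_eqI: "z $ pole = v $ pole \<Longrightarrow> rest z = rest v \<Longrightarrow> z = v"
  using UNIV_eq by (auto simp: vec_eq_iff rest_def) (metis UNIV_I insertE imageE)

lemma join_pole [simp]: "join w c $ pole = c"
  using pole_notin by (simp add: join_def)

lemma rest_join [simp]: "rest (join w c) = w"
  by (simp add: rest_def join_def vec_eq_iff inv_f_f[OF inj_e])

lemma bounded_linear_rest: "bounded_linear rest"
  unfolding linear_conv_bounded_linear[symmetric]
  by (rule linearI) (simp_all add: rest_def vec_eq_iff)

lemmas rest_simps =
  linear_add[OF bounded_linear.linear[OF bounded_linear_rest]]
  linear_diff[OF bounded_linear.linear[OF bounded_linear_rest]]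
  linear_scale[OF bounded_linear.linear[OF bounded_linear_rest]]
  linear_neg[OF bounded_linear.linear[OF bounded_linear_rest]]

lemma rest_rscale [simp]: "rest (rscale z c) = rscale (rest z) c"
  by (simp add: rest_def rscale_def vec_eq_iff)

lemma inner_join: "join w a \<bullet> join v b = w \<bullet> v + a \<bullet> b"
  by (simp add: inner_vec_def sum_eq) (simp add: join_def inv_f_f[OF inj_e])

lemma hermitian_join: "hermitian (join w a) (join v b) = hermitian w v + conjugate a * b"
  by (simp add: hermitian_def sum_eq) (simp add: join_def inv_f_f[OF inj_e])

lemma join_ne_0: "join w 1 \<noteq> 0"
  by (metis join_pole zero_index zero_neq_one)

lemma norm_join_sq: "(norm (join w 1))\<^sup>2 = 1 + w \<bullet> w"
  by (simp add: power2_norm_eq_inner inner_join inner_one_one)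

lemma eq_rscale_join:
  assumes "z $ pole \<noteq> 0"
  shows "z = rscale (join (affine_coords z) 1) (z $ pole)"
  by (rule vec_eqI) (simp_all add: affine_coords_def rscale_rscale assms)

text \<open>With \<open>w = affine_coords z\<close>, take norms in \<open>z = (w, 1) c\<close>,
  where \<open>c\<close> is the pole coordinate.\<close>

lemma norm_pole_sq:
  assumes "z $ pole \<noteq> 0" "norm z = 1"
  shows "(norm (z $ pole))\<^sup>2 = 1 / (1 + affine_coords z \<bullet> affine_coords z)"
proof -
  have "1 = norm (join (affine_coords z) 1) * norm (z $ pole)"
    using eq_rscale_join[OF assms(1)] assms(2) norm_rscale by metis
  then have "1 = (1 + affine_coords z \<bullet> affine_coords z) * (norm (z $ pole))\<^sup>2"
    using norm_join_sq by (metis power_mult_distrib power_one)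
  then show ?thesis
    by (metis divide_eq_eq mult.commute mult_zero_left zero_neq_one)
qed

lemma affine_coords_rscale:
  assumes "z $ pole \<noteq> 0" "c \<noteq> 0"
  shows "affine_coords (rscale z c) = affine_coords z"
  using assms by (simp add: affine_coords_def rscale_rscale nonzero_inverse_mult_distrib)
    (simp add: mult.assoc[symmetric])

lemma affine_coords_scaleR:
  assumes "z $ pole \<noteq> 0" "c \<noteq> 0"
  shows "affine_coords (c *\<^sub>R z) = affine_coords z"
  using affine_coords_rscale[OF assms(1), of "c *\<^sub>R 1"] assms(2) by (simp add: rscale_simps)

section \<open>First and second derivatives of the affine chart\<close>

lemma inverse_pole_has_derivative:
  fixes z :: "'k::{real_normed_div_algebra, euclidean_space} ^ 'm option"
  assumes "z $ pole \<noteq> 0"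
  shows "((\<lambda>z. inverse (z $ pole)) has_derivative
    (\<lambda>v. - (inverse (z $ pole) * v $ pole * inverse (z $ pole)))) (at z)"
  by (rule Deriv.has_derivative_inverse[where f = "\<lambda>z. z $ pole"])
    (rule assms bounded_linear_imp_has_derivative[OF bounded_linear_vec_nth])+

lemma affine_coords_has_derivative:
  assumes "z $ pole \<noteq> 0"
  shows "(affine_coords has_derivative daffine z) (at z)"
proof -
  have "((\<lambda>z. rscale (rest z) (inverse (z $ pole))) has_derivative
      (\<lambda>v. rscale (rest z) (- (inverse (z $ pole) * v $ pole * inverse (z $ pole))) +
        rscale (rest v) (inverse (z $ pole)))) (at z)"
    using assms
    by (intro bounded_bilinear.FDERIV[OF bounded_bilinear_rscale]
        bounded_linear_imp_has_derivative bounded_linear_rest inverse_pole_has_derivative)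
  then show ?thesis
    by (simp add: affine_coords_def[abs_def] daffine_def[abs_def] rscale_simps rscale_rscale mult.assoc)
qed

lemma daffine_has_derivative:
  assumes "z $ pole \<noteq> 0"
  shows "((\<lambda>z. daffine z v) has_derivative (\<lambda>u. d2affine z u v)) (at z)"
proof -
  have "((\<lambda>z. rest v - rscale (affine_coords z) (v $ pole)) has_derivative
      (\<lambda>u. 0 - rscale (daffine z u) (v $ pole))) (at z)"
    using affine_coords_has_derivative[OF assms]
    by (intro has_derivative_diff has_derivative_const
        bounded_linear.has_derivative[OF bounded_bilinear.bounded_linear_left[OF bounded_bilinear_rscale]])
  then have "((\<lambda>z. daffine z v) has_derivative
      (\<lambda>u. rscale (rest v - rscale (affine_coords z) (v $ pole))
            (- (inverse (z $ pole) * u $ pole * inverse (z $ pole))) +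
        rscale (0 - rscale (daffine z u) (v $ pole)) (inverse (z $ pole)))) (at z)"
    unfolding daffine_def using assms
    by (intro bounded_bilinear.FDERIV[OF bounded_bilinear_rscale]
        inverse_pole_has_derivative)
  then show ?thesis
    by (simp add: d2affine_def daffine_def[of z v] rscale_simps rscale_rscale algebra_simps)
qed

lemma open_pole_ne_0: "open {z :: 'k::{real_normed_div_algebra, euclidean_space} ^ 'm option. z $ pole \<noteq> 0}"
  by (intro open_Collect_neq continuous_intros)

lemma affine_coords_has_second_derivative:
  assumes "z $ pole \<noteq> 0"
  shows "has_second_derivative affine_coords daffine (d2affine z) z"
  unfolding has_second_derivative_def eventually_nhds
  using assms daffine_has_derivative affine_coords_has_derivative open_pole_ne_0 by blast

lemma daffine_rscale_self [simp]: "z $ pole \<noteq> 0 \<Longrightarrow> daffine z (rscale z c) = 0"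
  by (simp add: daffine_def affine_coords_def rscale_rscale rscale_simps mult.assoc)
    (simp add: mult.assoc[symmetric] rscale_simps)

lemma d2affine_rscale_self: "z $ pole \<noteq> 0 \<Longrightarrow> d2affine z (rscale z c) (rscale z c) = 0"
  by (simp add: d2affine_def rscale_simps)

lemma linear_daffine: "linear (daffine z)"
  by (rule linearI) (simp_all add: daffine_def rest_simps rscale_simps algebra_simps)

lemma daffine_eq_0D:
  assumes "z $ pole \<noteq> 0" "daffine z v = 0"
  shows "v = rscale z (inverse (z $ pole) * v $ pole)"
proof (rule vec_eqI)
  have "rscale (daffine z v) (z $ pole) = 0"
    by (simp add: assms(2) rscale_simps)
  then have "rest v = rscale (affine_coords z) (v $ pole)"
    using assms(1) by (simp add: daffine_def rscale_rscale)
  then show "rest v = rest (rscale z (inverse (z $ pole) * v $ pole))"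
    by (simp add: affine_coords_def rscale_rscale)
  show "v $ pole = rscale z (inverse (z $ pole) * v $ pole) $ pole"
    using assms(1) by (simp add: mult.assoc[symmetric])
qed

section \<open>Horizontal lifts\<close>

lemma lift_pole: "lift z v $ pole =
    - hermitian (affine_coords z) v /\<^sub>R (1 + affine_coords z \<bullet> affine_coords z) * z $ pole"
  by (simp add: lift_def Let_def)

lemma linear_lift: "linear (lift z)"
  by (rule linearI; rule vec_eqI)
    (simp_all add: lift_def Let_def rest_simps rscale_simps hermitian_simps algebra_simps)

lemma daffine_lift [simp]: "z $ pole \<noteq> 0 \<Longrightarrow> daffine z (lift z v) = v"
  by (simp add: daffine_def lift_def Let_def rscale_simps rscale_rscale mult.assoc)

lemma inj_lift: "z $ pole \<noteq> 0 \<Longrightarrow> inj (lift z)"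
  by (metis daffine_lift injI)

lemma hermitian_lift:
  assumes "z $ pole \<noteq> 0"
  shows "hermitian z (lift z v) = 0"
proof -
  define w where "w = affine_coords z"
  \<comment> \<open>The coefficient in \<open>lift\<close> comes from projecting
    \<open>(v, 0)\<close> off the line of \<open>(w, 1)\<close>: adding \<open>(w, 1) k\<close>
    changes its Hermitian product with \<open>(w, 1)\<close> by
    \<open>(1 + w \<bullet> w) k\<close>.\<close>
  define k where "k = - hermitian w v /\<^sub>R (1 + w \<bullet> w)"
  have "hermitian w v + (1 + w \<bullet> w) *\<^sub>R k = 0"
    using one_plus_inner_ne_0[of w] by (simp add: k_def)
  then have "hermitian (join w 1) (join (v + rscale w k) k) = 0"
    by (simp add: hermitian_join hermitian_simps hermitian_rscale_right hermitian_self algebra_simps)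
  then have "hermitian (rscale (join w 1) (z $ pole)) (lift z v) = 0"
    by (simp only: lift_def Let_def hermitian_rscale_left hermitian_rscale_right
        w_def[symmetric] k_def[symmetric]) simp
  then show ?thesis
    using eq_rscale_join[OF assms] by (simp add: w_def)
qed

text \<open>Two vectors with the same image under \<open>daffine z\<close> differ by some
  \<open>z c\<close>, and \<open>hermitian z\<close> takes \<open>z c\<close> to a nonzero real
  multiple of \<open>c\<close>.\<close>

lemma lift_unique:
  assumes "z $ pole \<noteq> 0" "hermitian z v = 0"
  shows "v = lift z (daffine z v)"
proof -
  let ?d = "v - lift z (daffine z v)"
  have "daffine z ?d = 0"
    using assms(1) by (simp add: linear_diff[OF linear_daffine])
  from daffine_eq_0D[OF assms(1) this] obtain c where c: "?d = rscale z c" ..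
  have "hermitian z ?d = 0"
    using assms by (simp add: hermitian_simps hermitian_lift)
  then have "(z \<bullet> z) *\<^sub>R c = 0"
    by (simp add: c hermitian_rscale_right hermitian_self)
  moreover have "z \<bullet> z \<noteq> 0"
    using assms(1) by auto
  ultimately have "?d = 0"
    by (simp add: c rscale_simps)
  then show ?thesis by simp
qed

text \<open>Up to right multiplication by \<open>z $ pole\<close>, a lift is \<open>(v, 0)\<close>
  minus its projection onto the line of \<open>(w, 1)\<close>. Pythagoras gives the difference of
  two terms, and \<open>norm_pole_sq\<close> the common factor
  \<open>1 / (1 + w \<bullet> w)\<close>.\<close>

lemma inner_lift:
  assumes "z $ pole \<noteq> 0" "norm z = 1"
  shows "lift z v \<bullet> lift z u = fubini_study (affine_coords z) v u"
proof -
  define w where "w = affine_coords z"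
  define N where "N = 1 + w \<bullet> w"
  have N: "N \<noteq> 0" unfolding N_def by (rule one_plus_inner_ne_0)
  have ww: "w \<bullet> w = N - 1" by (simp add: N_def)
  have "lift z v \<bullet> lift z u = (norm (z $ pole))\<^sup>2 *
      ((v + rscale w (- hermitian w v /\<^sub>R N)) \<bullet> (u + rscale w (- hermitian w u /\<^sub>R N))
       + (- hermitian w v /\<^sub>R N) \<bullet> (- hermitian w u /\<^sub>R N))"
    by (simp add: lift_def Let_def inner_rscale_rscale inner_join flip: w_def N_def)
  also have "\<dots> = 1 / N * ((v \<bullet> u) - (hermitian w v \<bullet> hermitian w u) / N)"
  proof -
    define a where "a = hermitian w v"
    define b where "b = hermitian w u"
    have 1: "v \<bullet> rscale w b = a \<bullet> b" "rscale w a \<bullet> u = a \<bullet> b"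
      by (simp_all add: inner_rscale_right inner_rscale_left a_def b_def)
    have 2: "rscale w a \<bullet> rscale w b = (N - 1) * (a \<bullet> b)"
      by (simp add: inner_rscale_left hermitian_rscale_right hermitian_self ww)
    have 3: "(v + rscale w (- a /\<^sub>R N)) \<bullet> (u + rscale w (- b /\<^sub>R N)) =
        v \<bullet> u - 2 * (a \<bullet> b) / N + (N - 1) * (a \<bullet> b) / N\<^sup>2"
      by (simp add: rscale_simps inner_diff_left inner_diff_right 1 2 divide_inverse
          power2_eq_square algebra_simps)
    show ?thesis
      using N unfolding norm_pole_sq[OF assms, folded w_def, folded N_def] a_def[symmetric] b_def[symmetric] 3
      by (simp add: field_simps power2_eq_square)
  qed
  finally show ?thesis
    using N by (simp add: fubini_study_def field_simps power2_eq_square flip: w_def N_def)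
qed

text \<open>The two terms of \<open>d2affine\<close> coincide, hence the factor 2; the minus sign in
  \<open>lift_pole\<close> cancels theirs.\<close>

lemma d2affine_lift:
  assumes "z $ pole \<noteq> 0"
  shows "d2affine z (lift z v) (lift z v) =
    (2 / (1 + affine_coords z \<bullet> affine_coords z)) *\<^sub>R rscale v (hermitian (affine_coords z) v)"
  using assms
  by (simp add: d2affine_def lift_pole mult.assoc rscale_simps)
    (simp add: divide_inverse flip: scaleR_add_left)

section \<open>The section over the chart\<close>

lemma section_map_pole: "section_map w $ pole \<noteq> 0"
  using join_ne_0[of w] by (simp add: section_map_def)

lemma norm_section_map: "norm (section_map w) = 1"
  using join_ne_0[of w] by (simp add: section_map_def)

lemma affine_coords_section_map [simp]: "affine_coords (section_map w) = w"
  unfolding section_map_def using join_ne_0[of w]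
  by (simp add: affine_coords_scaleR) (simp add: affine_coords_def)

text \<open>Positivity comes from the sphere: the form is the pullback of the Euclidean inner
  product by the injective linear map \<open>lift\<close>.\<close>

lemma inner_form_fubini_study: "inner_form (fubini_study w)"
  for w :: "'k::{real_normed_div_algebra, euclidean_space} ^ 'm"
  using inner_form_pullback[OF linear_lift inj_lift[OF section_map_pole[of w]]]
  by (simp add: inner_lift[OF section_map_pole[of w] norm_section_map[of w]])

lemma affine_param_eq: "affine_param e w = orbit (section_map w)"
  by (simp add: affine_param_def section_map_def homogenize_def join_def)

end

section \<open>Orbits and chart points\<close>

lemma orbit_eq: "orbit z = {rscale z u | u. norm u = 1}"
  for z :: "'k::{real_normed_div_algebra, euclidean_space} ^ 'n"
  by (simp add: orbit_def rscale_def)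

lemma orbit_rscale:
  fixes z :: "'k::{real_normed_div_algebra, euclidean_space} ^ 'n"
  assumes "norm u = 1"
  shows "orbit (rscale z u) = orbit z"
proof (intro equalityI subsetI)
  fix v assume "v \<in> orbit (rscale z u)"
  then obtain c where "norm c = 1" "v = rscale z (u * c)"
    by (auto simp: orbit_eq rscale_rscale)
  then show "v \<in> orbit z"
    using assms by (auto simp: orbit_eq norm_mult intro!: exI[of _ "u * c"])
next
  fix v assume "v \<in> orbit z"
  then obtain c where c: "norm c = 1" "v = rscale z c"
    by (auto simp: orbit_eq)
  have "u \<noteq> 0" using assms by auto
  then have "v = rscale (rscale z u) (inverse u * c)"
    by (simp add: c rscale_rscale mult.assoc[symmetric])
  then show "v \<in> orbit (rscale z u)"
    using assms c unfolding orbit_eq by (auto simp: norm_mult norm_inverse)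
qed

context affine_chart
begin

lemma orbit_eq_affine_param:
  assumes "z $ pole \<noteq> 0" "norm z = 1"
  shows "orbit z = affine_param e (affine_coords z)"
proof -
  let ?n = "norm (join (affine_coords z) 1)"
  have n: "?n > 0" using join_ne_0[of "affine_coords z"] by simp
  \<comment> \<open>The scalar between \<open>z\<close> and the section point over the same
    \<open>w\<close>; it has norm 1 because both points lie on the unit sphere.\<close>
  have z: "z = rscale (section_map (affine_coords z)) (?n *\<^sub>R z $ pole)"
    using eq_rscale_join[OF assms(1)] n by (simp add: section_map_def rscale_simps)
  have "1 = norm (section_map (affine_coords z)) * norm (?n *\<^sub>R z $ pole)"
    using z assms(2) norm_rscale by metis
  then have "norm (?n *\<^sub>R z $ pole) = 1"
    by (simp add: norm_section_map)
  from orbit_rscale[OF this, of "section_map (affine_coords z)"] show ?thesis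
    using z affine_param_eq by metis
qed

lemma orbit_eq_affine_paramD:
  assumes "orbit z = affine_param e w"
  shows "z $ pole \<noteq> 0" "affine_coords z = w"
proof -
  have "z \<in> orbit z"
    by (auto simp: orbit_eq intro!: exI[of _ 1])
  then obtain u where u: "norm u = 1" "z = rscale (section_map w) u"
    unfolding assms affine_param_eq by (auto simp: orbit_eq)
  then have "u \<noteq> 0" by auto
  then show "z $ pole \<noteq> 0" "affine_coords z = w"
    using u section_map_pole[of w] by (simp_all add: affine_coords_rscale)
qed

text \<open>Replaces the \<open>inv_into\<close> in \<open>diff_in_params\<close> by the explicit
  chart.\<close>

lemma inv_affine_param_orbit:
  assumes "z $ pole \<noteq> 0" "norm z = 1"
  shows "inv_into UNIV (affine_param e) (orbit z) = affine_coords z"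
proof -
  have "inj (affine_param e :: 'a ^ 'm \<Rightarrow> _)"
    by (rule injI) (metis affine_param_eq orbit_eq_affine_paramD(2))
  then show ?thesis
    unfolding orbit_eq_affine_param[OF assms] by simp
qed

end

lemma affine_chart_exists:
  fixes i :: "'m::finite option"
  shows "\<exists>e. affine_chart e \<and> affine_chart.pole e = i"
proof -
  have "card (UNIV :: 'm set) = card (UNIV - {i})"
    by simp
  then obtain e where e: "bij_betw e (UNIV :: 'm set) (UNIV - {i})"
    by (metis finite finite_same_card_bij)
  then interpret affine_chart e
    by unfold_locales (simp add: bij_betw_def)
  have "pole = i"
    using e pole_notin by (auto simp: bij_betw_def)
  then show ?thesis
    using affine_chart_axioms by blast
qed


section \<open>Parametrizations of the sphere\<close>

lemma round_sphere_params_iff: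
  "(U, p) \<in> params round_sphere \<longleftrightarrow> open U \<and> smooth_on U p
      \<and> (\<forall>x\<in>U. inj (frechet_derivative p (at x)))
      \<and> openin (top_of_set (sphere 0 1)) (p ` U)
      \<and> homeomorphism U (p ` U) p (inv_into U p)"
  by (simp add: round_sphere_def)

lemma metric_round_sphere:
  "metric round_sphere (U, p) =
    (\<lambda>x v w. frechet_derivative p (at x) v \<bullet> frechet_derivative p (at x) w)"
  by (simp add: round_sphere_def)

lemma smooth_on_has_derivative:
  assumes "smooth_on U p" "x \<in> U"
  shows "(p has_derivative frechet_derivative p (at x)) (at x)"
proof -
  have "C_n_on (Suc 0) U p"
    using assms(1) unfolding smooth_on_def by blast
  then show ?thesis
    using assms(2) C_n_on_Suc_has_derivative by blast
qed

lemma round_sphere_param_has_derivative: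
  assumes "(U, p) \<in> params round_sphere" "x \<in> U"
  shows "(p has_derivative frechet_derivative p (at x)) (at x)"
  using assms smooth_on_has_derivative unfolding round_sphere_params_iff by blast

lemma norm_round_sphere_param:
  assumes "(U, p) \<in> params round_sphere" "x \<in> U"
  shows "norm (p x) = 1"
proof -
  have "p ` U \<subseteq> sphere 0 1"
    using assms(1) openin_imp_subset unfolding round_sphere_params_iff by blast
  with assms(2) show ?thesis by auto
qed

text \<open>Differentiating \<open>p y \<bullet> p y = 1\<close> gives one inclusion; injectivity
  and \<open>dim\<close> make the dimensions agree.\<close>

lemma range_round_sphere_param_derivative:
  fixes p :: "'e::euclidean_space \<Rightarrow> 'a::euclidean_space"
  assumes dim: "DIM('e) + 1 = DIM('a)"
    and p: "(U, p) \<in> params round_sphere" and x: "x \<in> U"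
  shows "range (frechet_derivative p (at x)) = {v. p x \<bullet> v = 0}"
proof (rule subspace_dim_equal)
  let ?D = "frechet_derivative p (at x)"
  note D = round_sphere_param_has_derivative[OF p x]
  have U: "open U" and inj: "inj ?D"
    using p x unfolding round_sphere_params_iff by auto
  show "subspace (range ?D)"
    by (rule linear_subspace_image[OF has_derivative_linear[OF D] subspace_UNIV])
  show "subspace {v. p x \<bullet> v = 0}"
    by (rule subspace_hyperplane)
  have "((\<lambda>y. p y \<bullet> p y) has_derivative (\<lambda>v. p x \<bullet> ?D v + ?D v \<bullet> p x)) (at x)"
    by (rule has_derivative_inner[OF D D])
  moreover have "((\<lambda>y. p y \<bullet> p y) has_derivative (\<lambda>v. 0)) (at x)"
  proof (rule has_derivative_transform_within_open[OF has_derivative_const U x])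
    show "1 = p y \<bullet> p y" if "y \<in> U" for y
      using norm_round_sphere_param[OF p that] by (simp add: norm_eq_1)
  qed
  ultimately have "(\<lambda>v. p x \<bullet> ?D v + ?D v \<bullet> p x) = (\<lambda>v. 0)"
    by (rule has_derivative_unique)
  then have "p x \<bullet> ?D v + ?D v \<bullet> p x = 0" for v
    by (rule fun_cong)
  then have "p x \<bullet> ?D v = 0" for v
    using inner_commute[of "p x" "?D v"] by (metis add_cancel_left_left double_eq_0_iff)
  then show "range ?D \<subseteq> {v. p x \<bullet> v = 0}"
    by auto
  have "p x \<noteq> 0"
    using norm_round_sphere_param[OF p x] by auto
  then have "dim {v. p x \<bullet> v = 0} = DIM('a) - 1"
    by (rule dim_hyperplane)
  moreover have "dim (range ?D) = DIM('e)"
    using dim_image_eq[OF has_derivative_linear[OF D], of UNIV] inj by simp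
  ultimately show "dim {v. p x \<bullet> v = 0} \<le> dim (range ?D)"
    using dim by simp
qed

text \<open>Central projection of the sphere from its centre onto the tangent hyperplane at \<open>z\<close>.\<close>

lemma central_projection_param:
  fixes z :: "'a::euclidean_space"
  assumes dim: "DIM('e::euclidean_space) + 1 = DIM('a)" and z: "norm z = 1"
  shows "\<exists>(p :: 'e \<Rightarrow> 'a) r. (UNIV, p) \<in> params round_sphere \<and> smooth_on {y. 0 < y \<bullet> z} r \<and>
    (\<forall>y. norm y = 1 \<and> 0 < y \<bullet> z \<longrightarrow> p (r y) = y)"
proof -
  have zz: "z \<bullet> z = 1"
    using z by (simp add: norm_eq_1)
  have dim_eq: "dim (UNIV :: 'e set) = dim {v. z \<bullet> v = 0}"
    using dim zz dim_hyperplane[of z] by fastforce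
  obtain f :: "'e \<Rightarrow> 'a" and g where f: "linear f" "f ` UNIV = {v. z \<bullet> v = 0}"
    and g: "linear g" and gf: "\<And>x. g (f x) = x" and fg: "\<And>v. z \<bullet> v = 0 \<Longrightarrow> f (g v) = v"
    by (rule isometries_subspaces[OF subspace_UNIV subspace_hyperplane dim_eq]) (rule that, auto)
  have zf: "z \<bullet> f x = 0" for x
    using f(2) by auto
  define n where "n x = norm (z + f x)" for x
  define p where "p x = (z + f x) /\<^sub>R n x" for x
  \<comment> \<open>The ray through \<open>y\<close> meets the tangent hyperplane in
    \<open>y\<close> divided by \<open>y \<bullet> z\<close>. The formula makes sense on an open
    half-space, not just on the sphere, so \<open>smooth_on\<close> applies and \<open>r\<close> can
    be composed with \<open>section_map\<close>.\<close>
  define r where "r y = g (inverse (y \<bullet> z) *\<^sub>R y - z)" for y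
  have ne: "z + f x \<noteq> 0" for x
  proof
    assume "z + f x = 0"
    then have "z \<bullet> (z + f x) = 0" by simp
    then show False using zz zf by (simp add: inner_add_right)
  qed
  then have n: "n x > 0" for x
    by (simp add: n_def)
  have norm_p: "norm (p x) = 1" for x
    using n[of x] by (simp add: p_def n_def)
  have pz: "p x \<bullet> z = inverse (n x)" for x
    using zf[of x] zz by (simp add: p_def inner_add_left inner_commute[of "f x" z])
  have rp: "r (p x) = x" for x
    unfolding r_def pz using n[of x] by (simp add: p_def gf)
  have pr: "p (r y) = y" if "norm y = 1" "0 < y \<bullet> z" for y
  proof -
    have "z \<bullet> (inverse (y \<bullet> z) *\<^sub>R y - z) = 0"
      using that(2) zz by (simp add: inner_diff_right inner_commute[of z y])
    then have "z + f (r y) = inverse (y \<bullet> z) *\<^sub>R y"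
      by (simp add: r_def fg)
    then show ?thesis
      using that by (simp add: p_def n_def)
  qed
  have "open {y. 0 < y \<bullet> z}"
    by (intro open_Collect_less continuous_intros)
  then have r: "smooth_on {y. 0 < y \<bullet> z} r"
    unfolding r_def
    by (intro smooth_on_bounded_linear[of g] smooth_on_add[where g = "\<lambda>_. - z", unfolded diff_conv_add_uminus[symmetric]]
        smooth_on_bilinear[OF bounded_bilinear_scaleR] smooth_on_inverse smooth_on_id smooth_on_const
        smooth_on_bounded_linear[OF bounded_linear_inner_left])
      (use g linear_conv_bounded_linear in auto)
  have smooth_p: "smooth_on UNIV p"
    unfolding p_def n_def
    by (intro smooth_on_normalize smooth_on_add smooth_on_const smooth_on_bounded_linear[of f] smooth_on_id)
      (use f ne linear_conv_bounded_linear in auto)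
  have image: "p ` UNIV = sphere 0 1 \<inter> {y. 0 < y \<bullet> z}"
  proof (intro equalityI subsetI)
    fix y assume "y \<in> sphere 0 1 \<inter> {y. 0 < y \<bullet> z}"
    then show "y \<in> p ` UNIV"
      using pr[of y] by (metis IntD1 IntD2 mem_Collect_eq mem_sphere_0 rangeI)
  qed (use norm_p pz n in auto)
  have inv: "inv_into UNIV p y = r y" if "y \<in> p ` UNIV" for y
    using that rp by (auto simp: inv_f_f[OF inj_on_inverseI[of UNIV r p]])
  have "(UNIV, p) \<in> params round_sphere"
    unfolding round_sphere_params_iff
  proof (intro conjI ballI)
    fix x
    have "p x \<in> {y. 0 < y \<bullet> z}"
      using pz n by simp
    \<comment> \<open>Differentiating \<open>r (p x) = x\<close> yields a left inverse of the
      derivative of \<open>p\<close>.\<close>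
    from diff_chain_at[OF smooth_on_has_derivative[OF smooth_p UNIV_I] smooth_on_has_derivative[OF r this]]
    have "((\<lambda>x. x) has_derivative (frechet_derivative r (at (p x)) \<circ> frechet_derivative p (at x))) (at x)"
      by (simp add: o_def rp)
    from has_derivative_unique[OF this has_derivative_ident]
    have "frechet_derivative r (at (p x)) (frechet_derivative p (at x) v) = v" for v
      by (simp add: fun_eq_iff)
    then show "inj (frechet_derivative p (at x))"
      by (metis injI)
  next
    show "openin (top_of_set (sphere 0 1)) (p ` UNIV)"
      unfolding image using \<open>open {y. 0 < y \<bullet> z}\<close> by blast
    show "homeomorphism UNIV (p ` UNIV) p (inv_into UNIV p)"
      unfolding homeomorphism_def
    proof (intro conjI ballI)
      show "continuous_on UNIV p"
        using smooth_p by (rule smooth_on_imp_continuous_on)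
      have "continuous_on (p ` UNIV) r"
        using smooth_on_imp_continuous_on[OF r] by (rule continuous_on_subset) (use image in blast)
      then show "continuous_on (p ` UNIV) (inv_into UNIV p)"
        using inv by (simp cong: continuous_on_cong)
      show "inv_into UNIV p ` p ` UNIV = UNIV"
        using inv rp by (auto simp: image_image)
    qed (use inv rp in auto)
  qed (use smooth_p in auto)
  then show ?thesis
    using r pr by blast
qed

lemma round_sphere_param_exists:
  fixes z :: "'a::euclidean_space"
  assumes "DIM('e::euclidean_space) + 1 = DIM('a)" "norm z = 1"
  shows "\<exists>(U :: 'e set) p x. (U, p) \<in> params round_sphere \<and> x \<in> U \<and> p x = z"
proof -
  obtain p :: "'e \<Rightarrow> 'a" and r where "(UNIV, p) \<in> params round_sphere"
      "\<forall>y. norm y = 1 \<and> 0 < y \<bullet> z \<longrightarrow> p (r y) = y"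
    using central_projection_param[OF assms] by blast
  then show ?thesis
    using assms(2) by (metis UNIV_I inner_gt_zero_iff norm_zero zero_neq_one)
qed


section \<open>The submersion metric\<close>

context affine_chart
begin

text \<open>On the neighbourhood of \<open>x\<close> where the pole coordinate is nonzero, the map
  differentiated in \<open>diff_in_params\<close> is \<open>affine_coords \<circ> p\<close>.\<close>

lemma diff_in_params_orbit:
  fixes p :: "'e::euclidean_space \<Rightarrow> 'k::{real_normed_div_algebra, euclidean_space} ^ 'm option"
  assumes p: "(U, p) \<in> params round_sphere" and x: "x \<in> U" and pole: "p x $ pole \<noteq> 0"
  shows "diff_in_params orbit (U, p) (UNIV, affine_param e) x v =
    daffine (p x) (frechet_derivative p (at x) v)"
proof -
  note D = round_sphere_param_has_derivative[OF p x]
  have "((\<lambda>y. affine_coords (p y)) has_derivative (\<lambda>v. daffine (p x) (frechet_derivative p (at x) v))) (at x)"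
    using diff_chain_at[OF D affine_coords_has_derivative[OF pole]] by (simp add: o_def)
  moreover have "\<forall>\<^sub>F y in nhds x.
      affine_coords (p y) = (inv_into UNIV (affine_param e) \<circ> orbit \<circ> p) y"
  proof -
    have "continuous_on U p" "open U"
      using p smooth_on_imp_continuous_on unfolding round_sphere_params_iff by blast+
    then have "open (U \<inter> p -` {z. z $ pole \<noteq> 0})"
      using continuous_open_preimage open_pole_ne_0 by blast
    then show ?thesis
      unfolding eventually_nhds
      using pole x norm_round_sphere_param[OF p]
      by (intro exI[of _ "U \<inter> p -` {z. z $ pole \<noteq> 0}"]) (auto simp: inv_affine_param_orbit)
  qed
  ultimately have "((inv_into UNIV (affine_param e) \<circ> orbit \<circ> p) has_derivative
      (\<lambda>v. daffine (p x) (frechet_derivative p (at x) v))) (at x)"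
    by (rule has_derivative_transform_nhds)
  from frechet_derivative_at[OF this] show ?thesis
    by (simp add: diff_in_params_def fun_eq_iff)
qed

text \<open>Horizontality tests only vertical vectors tangent to the sphere, \<open>z c\<close> with
  \<open>c\<close> imaginary. The real direction is covered because \<open>?D v\<close> is itself
  tangent, so the two conditions together say that the Hermitian product vanishes.\<close>

lemma horizontal_iff:
  fixes p :: "'e::euclidean_space \<Rightarrow> 'k::{real_normed_div_algebra, euclidean_space} ^ 'm option"
  assumes dim: "DIM('e) + 1 = DIM('k ^ 'm option)"
    and p: "(U, p) \<in> params round_sphere" and x: "x \<in> U" and pole: "p x $ pole \<noteq> 0"
  shows "v \<in> horizontal round_sphere orbit (U, p) (UNIV, affine_param e) x \<longleftrightarrow>
    hermitian (p x) (frechet_derivative p (at x) v) = 0"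
proof -
  let ?D = "frechet_derivative p (at x)"
  define h where "h = hermitian (p x) (?D v)"
  note range = range_round_sphere_param_derivative[OF dim p x]
  have "p x \<bullet> ?D v = 0"
    using range by auto
  then have h1: "1 \<bullet> h = 0"
    by (simp add: h_def inner_eq_inner_hermitian)
  have hor: "v \<in> horizontal round_sphere orbit (U, p) (UNIV, affine_param e) x \<longleftrightarrow>
      (\<forall>u. daffine (p x) (?D u) = 0 \<longrightarrow> ?D v \<bullet> ?D u = 0)"
    by (simp add: horizontal_def diff_in_params_orbit[OF p x pole] metric_round_sphere)
  show ?thesis
    unfolding hor
  proof
    assume *: "\<forall>u. daffine (p x) (?D u) = 0 \<longrightarrow> ?D v \<bullet> ?D u = 0"
    have "p x \<bullet> p x = 1"
      using norm_round_sphere_param[OF p x] by (simp add: norm_eq_1)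
    \<comment> \<open>The test vector is \<open>z h\<close> with \<open>h\<close> itself as the
      scalar: \<open>h\<close> is imaginary, so \<open>z h\<close> is tangent, and pairing
      \<open>?D v\<close> with it gives \<open>h \<bullet> h\<close>.\<close>
    then have "p x \<bullet> rscale (p x) h = 0"
      using h1 by (simp add: inner_eq_inner_hermitian[of "p x" "rscale (p x) h"]
          hermitian_rscale_right hermitian_self)
    then obtain u where "rscale (p x) h = ?D u"
      using range by (metis (mono_tags, lifting) imageE mem_Collect_eq)
    with * pole have "?D v \<bullet> rscale (p x) h = 0"
      by (metis daffine_rscale_self)
    then have "h \<bullet> h = 0"
      by (simp add: inner_rscale_right h_def)
    then show "hermitian (p x) (?D v) = 0"
      by (simp add: h_def)
  next
    assume *: "hermitian (p x) (?D v) = 0"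
    show "\<forall>u. daffine (p x) (?D u) = 0 \<longrightarrow> ?D v \<bullet> ?D u = 0"
    proof (intro allI impI)
      fix u assume "daffine (p x) (?D u) = 0"
      from daffine_eq_0D[OF pole this] obtain c where "?D u = rscale (p x) c" ..
      then show "?D v \<bullet> ?D u = 0"
        using * by (simp add: inner_rscale_right)
    qed
  qed
qed

lemma submersion_metric_eq_fubini_study:
  fixes w :: "'k::{real_normed_div_algebra, euclidean_space} ^ 'm"
  assumes dim: "DIM('e::euclidean_space) + 1 = DIM('k ^ 'm option)"
  shows "submersion_metric (round_sphere :: ('k ^ 'm option, 'e) riemannian) orbit
    (UNIV, affine_param e) w v u = fubini_study w v u"
  unfolding submersion_metric_def
proof (rule the_equality)
  let ?S = "round_sphere :: ('k ^ 'm option, 'e) riemannian"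
  \<comment> \<open>Every horizontal vector is the lift of its image, and inner products of lifts
    depend only on \<open>w\<close>; this frees the value from the choice of parametrization and of
    point in the fibre.\<close>
  have horizontal_lift: "frechet_derivative p (at x) a = lift (p x) b"
    if "(U, p) \<in> params ?S" "x \<in> U" "p x $ pole \<noteq> 0"
      "a \<in> horizontal ?S orbit (U, p) (UNIV, affine_param e) x"
      "diff_in_params orbit (U, p) (UNIV, affine_param e) x a = b" for U p x a b
    using that lift_unique[OF that(3)] horizontal_iff[OF dim that(1,2,3)]
      diff_in_params_orbit[OF that(1,2,3)] by metis
  show "\<forall>(U, p)\<in>params ?S. \<forall>x\<in>U. orbit (p x) = snd (UNIV, affine_param e) w \<longrightarrow>
      (\<forall>a\<in>horizontal ?S orbit (U, p) (UNIV, affine_param e) x.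
       \<forall>b\<in>horizontal ?S orbit (U, p) (UNIV, affine_param e) x.
         diff_in_params orbit (U, p) (UNIV, affine_param e) x a = v \<and>
         diff_in_params orbit (U, p) (UNIV, affine_param e) x b = u \<longrightarrow>
         metric ?S (U, p) x a b = fubini_study w v u)"
  proof (clarify, unfold snd_conv)
    fix U p x a b
    assume p: "(U, p) \<in> params ?S" and x: "x \<in> U" and o: "orbit (p x) = affine_param e w"
      and ab: "a \<in> horizontal ?S orbit (U, p) (UNIV, affine_param e) x"
        "b \<in> horizontal ?S orbit (U, p) (UNIV, affine_param e) x"
    note pole = orbit_eq_affine_paramD[OF o]
    show "metric ?S (U, p) x a b = fubini_study w
        (diff_in_params orbit (U, p) (UNIV, affine_param e) x a)
        (diff_in_params orbit (U, p) (UNIV, affine_param e) x b)"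
      using inner_lift[OF pole(1) norm_round_sphere_param[OF p x]] pole(2)
      by (simp add: metric_round_sphere horizontal_lift[OF p x pole(1) ab(1) refl]
          horizontal_lift[OF p x pole(1) ab(2) refl])
  qed
  fix r
  assume r: "\<forall>(U, p)\<in>params ?S. \<forall>x\<in>U. orbit (p x) = snd (UNIV, affine_param e) w \<longrightarrow>
      (\<forall>a\<in>horizontal ?S orbit (U, p) (UNIV, affine_param e) x.
       \<forall>b\<in>horizontal ?S orbit (U, p) (UNIV, affine_param e) x.
         diff_in_params orbit (U, p) (UNIV, affine_param e) x a = v \<and>
         diff_in_params orbit (U, p) (UNIV, affine_param e) x b = u \<longrightarrow>
         metric ?S (U, p) x a b = r)"
  \<comment> \<open>Without a parametrization and horizontal vectors over \<open>w\<close> the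
    condition on \<open>r\<close> would hold vacuously; the section point supplies them.\<close>
  let ?z = "section_map w"
  obtain U :: "'e set" and p x where p: "(U, p) \<in> params ?S" and x: "x \<in> U" and px: "p x = ?z"
    using round_sphere_param_exists[OF dim norm_section_map[of w]] by blast
  have pole: "p x $ pole \<noteq> 0"
    using px section_map_pole[of w] by simp
  have "?z \<bullet> lift ?z a = 0" for a
    by (simp add: inner_eq_inner_hermitian hermitian_lift section_map_pole)
  then have "lift ?z a \<in> range (frechet_derivative p (at x))" for a
    unfolding range_round_sphere_param_derivative[OF dim p x] px by simp
  then obtain a b where a: "frechet_derivative p (at x) a = lift ?z v"
      and b: "frechet_derivative p (at x) b = lift ?z u"
    by (metis imageE)
  have "a \<in> horizontal ?S orbit (U, p) (UNIV, affine_param e) x"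
      "b \<in> horizontal ?S orbit (U, p) (UNIV, affine_param e) x"
    unfolding horizontal_iff[OF dim p x pole] a b px
    using hermitian_lift[OF section_map_pole[of w]] by auto
  moreover have "diff_in_params orbit (U, p) (UNIV, affine_param e) x a = v"
      "diff_in_params orbit (U, p) (UNIV, affine_param e) x b = u"
    unfolding diff_in_params_orbit[OF p x pole] a b px
    using daffine_lift[OF section_map_pole[of w]] by auto
  moreover have "orbit (p x) = snd (UNIV, affine_param e) w"
    by (simp add: px affine_param_eq)
  ultimately have "metric ?S (U, p) x a b = r"
    using r p x by fastforce
  then show "r = fubini_study w v u"
    using inner_lift[OF section_map_pole[of w] norm_section_map[of w], of v u]
    by (simp add: metric_round_sphere a b)
qed


section \<open>Comparison of gradients and Laplacians\<close>

text \<open>The vertical part is an orthonormal basis \<open>C\<close> of the imaginary scalars,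
  moved by \<open>c \<mapsto> z c\<close>, an isometry as \<open>norm z = 1\<close>. The count is
  \<open>DIM('k ^ 'm) + (DIM('k) - 1) = DIM('e)\<close>; for real scalars \<open>C\<close> is
  empty.\<close>

lemma adapted_frame_exists:
  fixes z :: "'k::{real_normed_div_algebra, euclidean_space} ^ 'm option"
    and D :: "'e::euclidean_space \<Rightarrow> 'k ^ 'm option"
  assumes dim: "DIM('e) + 1 = DIM('k ^ 'm option)"
    and z: "norm z = 1" "z $ pole \<noteq> 0" and range: "range D = {v. z \<bullet> v = 0}"
    and b: "orthonormal_frame (fubini_study (affine_coords z)) I b"
  shows "\<exists>(C :: 'k set) a. orthonormal_frame (\<lambda>v u. D v \<bullet> D u) (I <+> C) a \<and>
    (\<forall>i. D (a (Inl i)) = lift z (b i)) \<and> (\<forall>c\<in>C. D (a (Inr c)) = rscale z c)"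
proof -
  have zz: "z \<bullet> z = 1"
    using z by (simp add: norm_eq_1)
  obtain C :: "'k set" where C: "C \<subseteq> {c. 1 \<bullet> c = 0}" "pairwise orthogonal C" "\<And>c. c \<in> C \<Longrightarrow> norm c = 1"
      "independent C" "card C = dim {c :: 'k. 1 \<bullet> c = 0}"
    using orthonormal_basis_subspace[OF subspace_hyperplane] by metis
  have "finite C"
    using C(4) by (rule independent_imp_finite)
  have "card C = DIM('k) - 1"
    using C(5) dim_hyperplane[of "1 :: 'k"] by simp
  moreover have "DIM('k) > 0" by simp
  ultimately have cardC: "card C + 1 = DIM('k)"
    by linarith
  define a where "a = case_sum (\<lambda>i. inv D (lift z (b i))) (\<lambda>c. inv D (rscale z c))"
  have "z \<bullet> lift z v = 0" for v
    by (simp add: inner_eq_inner_hermitian hermitian_lift z)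
  then have Inl: "D (a (Inl i)) = lift z (b i)" for i
    using range by (simp add: a_def f_inv_into_f)
  have "z \<bullet> rscale z c = 0" if "c \<in> C" for c
    using that C(1) by (auto simp: inner_eq_inner_hermitian[of z "rscale z c"]
        hermitian_rscale_right hermitian_self zz)
  then have Inr: "D (a (Inr c)) = rscale z c" if "c \<in> C" for c
    using that range by (simp add: a_def f_inv_into_f)
  have "orthonormal_frame (\<lambda>v u. D v \<bullet> D u) (I <+> C) a"
    unfolding orthonormal_frame_def
  proof (intro conjI ballI)
    show "finite (I <+> C)"
      using b \<open>finite C\<close> by (simp add: orthonormal_frame_def)
    show "card (I <+> C) = DIM('e)"
      using b \<open>finite C\<close> cardC dim by (simp add: orthonormal_frame_def card_Plus)
    fix i j assume ij: "i \<in> I <+> C" "j \<in> I <+> C"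
    have ll: "lift z (b i) \<bullet> lift z (b j) = (if i = j then 1 else 0)" if "i \<in> I" "j \<in> I" for i j
      using b that by (simp add: inner_lift z orthonormal_frame_def)
    have lc: "rscale z c \<bullet> lift z v = 0" "lift z v \<bullet> rscale z c = 0" for c v
      by (simp_all add: inner_rscale_left inner_rscale_right hermitian_lift z)
    have cc: "rscale z c \<bullet> rscale z d = (if c = d then 1 else 0)" if "c \<in> C" "d \<in> C" for c d
      using that C(2,3) by (auto simp: inner_rscale_left hermitian_rscale_right hermitian_self zz
          pairwise_def orthogonal_def norm_eq_1)
    show "D (a i) \<bullet> D (a j) = (if i = j then 1 else 0)"
      using ij by (auto simp: Inl Inr ll lc cc split: if_splits)
  qed
  then show ?thesis
    using Inl Inr by blast
qed

context
  fixes U :: "'e::euclidean_space set" and p :: "'e \<Rightarrow> 'k::{real_normed_div_algebra, euclidean_space} ^ 'm option"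
    and x :: 'e
  assumes dim: "DIM('e) + 1 = DIM('k ^ 'm option)"
    and p: "(U, p) \<in> params round_sphere" and x: "x \<in> U" and pole: "p x $ pole \<noteq> 0"
begin

lemma param_inner_form: "y \<in> U \<Longrightarrow> inner_form (metric round_sphere (U, p) y)"
  unfolding metric_round_sphere
  using p has_derivative_linear[OF round_sphere_param_has_derivative[OF p]]
  by (intro inner_form_pullback) (auto simp: round_sphere_params_iff)

lemma fubini_study_frame:
  "\<exists>(I :: ('k ^ 'm option) set) b. orthonormal_frame (fubini_study (affine_coords (p x))) I b"
  using orthonormal_frame_pullback_exists[OF linear_lift inj_lift[OF pole]]
  by (simp add: inner_lift[OF pole norm_round_sphere_param[OF p x]])

text \<open>Parseval on both sides: in the adapted frame the vertical terms drop out, and the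
  horizontal ones are the derivatives of \<open>\<phi>\<close> and \<open>\<psi>\<close> along
  \<open>b\<close>.\<close>

lemma grad_inner_grad_orbit:
  assumes \<phi>: "(\<phi> has_derivative \<phi>') (at (affine_coords (p x)))"
    and \<psi>: "(\<psi> has_derivative \<psi>') (at (affine_coords (p x)))"
    and f: "\<forall>\<^sub>F y in nhds x. f y = \<phi> (affine_coords (p y))"
    and k: "\<forall>\<^sub>F y in nhds x. k y = \<psi> (affine_coords (p y))"
  shows "metric round_sphere (U, p) x
      (grad (metric round_sphere (U, p)) f x) (grad (metric round_sphere (U, p)) k x) =
    fubini_study (affine_coords (p x))
      (grad fubini_study \<phi> (affine_coords (p x))) (grad fubini_study \<psi> (affine_coords (p x)))"
proof -
  let ?D = "frechet_derivative p (at x)"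
  note z = norm_round_sphere_param[OF p x] pole
  obtain I :: "('k ^ 'm option) set" and b where b: "orthonormal_frame (fubini_study (affine_coords (p x))) I b"
    using fubini_study_frame by blast
  obtain C a where a: "orthonormal_frame (metric round_sphere (U, p) x) (I <+> C) a"
      and Inl: "\<And>i. ?D (a (Inl i)) = lift (p x) (b i)"
      and Inr: "\<And>c. c \<in> C \<Longrightarrow> ?D (a (Inr c)) = rscale (p x) c"
    using adapted_frame_exists[OF dim z range_round_sphere_param_derivative[OF dim p x] b]
    unfolding metric_round_sphere by blast
  have fin: "finite I" "finite C"
    using a by (auto simp: orthonormal_frame_def)
  have chain: "(f has_derivative (\<lambda>v. \<phi>' (daffine (p x) (?D v)))) (at x)"
    if "(\<phi> has_derivative \<phi>') (at (affine_coords (p x)))" "\<forall>\<^sub>F y in nhds x. f y = \<phi> (affine_coords (p y))"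
    for f :: "'e \<Rightarrow> real" and \<phi> \<phi>'
  proof (rule has_derivative_transform_nhds)
    show "((\<lambda>y. \<phi> (affine_coords (p y))) has_derivative (\<lambda>v. \<phi>' (daffine (p x) (?D v)))) (at x)"
      using diff_chain_at[OF diff_chain_at[OF round_sphere_param_has_derivative[OF p x]
            affine_coords_has_derivative[OF pole]]] that(1) by (simp add: o_def)
    show "\<forall>\<^sub>F y in nhds x. \<phi> (affine_coords (p y)) = f y"
      using that(2) by eventually_elim simp
  qed
  have lin: "linear \<phi>'"
    using \<phi> by (rule has_derivative_linear)
  show ?thesis
    using fin grad_inner_grad[of "metric round_sphere (U, p)" x, OF param_inner_form[OF x] a chain[OF \<phi> f] chain[OF \<psi> k]]
      grad_inner_grad[of fubini_study "affine_coords (p x)", OF inner_form_fubini_study b \<phi> \<psi>]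
    by (simp add: sum.Plus Inl Inr pole linear_0[OF lin])
qed

lemma laplacian_orbit:
  assumes \<phi>: "has_second_derivative \<phi> \<phi>' \<phi>'' (affine_coords (p x))"
    and f: "\<forall>\<^sub>F y in nhds x. f y = \<phi> (affine_coords (p y))"
  shows "laplacian (metric round_sphere (U, p)) f x = laplacian fubini_study \<phi> (affine_coords (p x))"
proof -
  define z where "z = p x"
  define w where "w = affine_coords z"
  define p' where "p' = (\<lambda>y. frechet_derivative p (at y))"
  define p'' where "p'' = (\<lambda>d v. frechet_derivative (\<lambda>y. p' y v) (at x) d)"
  define g where "g = metric round_sphere (U, p)"
  have g: "g = (\<lambda>y v u. p' y v \<bullet> p' y u)"
    by (simp add: g_def p'_def metric_round_sphere)
  have z: "norm z = 1" "z $ pole \<noteq> 0"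
    using norm_round_sphere_param[OF p x] pole by (simp_all add: z_def)
  have range: "range (p' x) = {v. z \<bullet> v = 0}"
    using range_round_sphere_param_derivative[OF dim p x] by (simp add: p'_def z_def)
  have p2: "has_second_derivative p p' p'' x"
    using smooth_on_has_second_derivative[of U p x] p x
    unfolding p'_def p''_def round_sphere_params_iff by simp
  have \<phi>w: "has_second_derivative \<phi> \<phi>' \<phi>'' w"
    using \<phi> by (simp add: w_def z_def)
  \<comment> \<open>Derivatives of the extension of \<open>f\<close> to the ambient space that is
    constant on scalar lines.\<close>
  define F' where "F' = (\<lambda>y v. \<phi>' (affine_coords y) (daffine y v))"
  define F'' where "F'' = (\<lambda>d v. \<phi>'' (daffine z d) (daffine z v) + \<phi>' w (d2affine z d v))"
  have "has_second_derivative (\<lambda>y. \<phi> (affine_coords y)) F' F'' z"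
    unfolding F'_def F''_def w_def
    by (rule has_second_derivative_compose[OF affine_coords_has_second_derivative[OF z(2)] \<phi>w[unfolded w_def]])
  from has_second_derivative_compose[OF p2 this[unfolded z_def]]
  have f2: "has_second_derivative f (\<lambda>y v. F' (p y) (p' y v))
      (\<lambda>d v. F'' (p' x d) (p' x v) + F' z (p'' d v)) x"
    using f has_second_derivative_cong unfolding z_def by blast
  have lin\<phi>: "linear (\<phi>' w)" "linear (\<lambda>d. \<phi>'' d v)" for v
    using has_second_derivativeD[OF \<phi>w] has_derivative_linear by blast+

  have gU: "\<forall>\<^sub>F y in nhds x. inner_form (g y)"
    unfolding eventually_nhds g_def
    using param_inner_form x p by (intro exI[of _ U]) (auto simp: round_sphere_params_iff)
  define X where "X = grad g f x"
  have X: "p' x X \<bullet> p' x v = F' z (p' x v)" for v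
    using grad_inner[of g x f, OF eventually_nhds_x_imp_x[OF gU] has_second_derivativeD(1)[OF f2]]
    by (simp add: g X_def z_def)
  \<comment> \<open>The ambient derivative kills the radial direction, so it is represented by a
    tangent vector, the gradient on the sphere. As this holds for every ambient \<open>u\<close>, it
    applies to \<open>p'' d v\<close>, whose normal part contributes nothing.\<close>
  have FX: "F' z u = u \<bullet> p' x X" for u
  proof -
    have "z \<bullet> (u - (z \<bullet> u) *\<^sub>R z) = 0"
      using z(1) by (simp add: inner_diff_right norm_eq_1)
    then obtain v where v: "u - (z \<bullet> u) *\<^sub>R z = p' x v"
      using range by (metis (mono_tags, lifting) imageE mem_Collect_eq)
    have "daffine z z = 0"
      using daffine_rscale_self[OF z(2), of 1] by simp
    then have "F' z (u - (z \<bullet> u) *\<^sub>R z) = F' z u"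
      by (simp add: F'_def linear_diff[OF linear_daffine] linear_scale[OF linear_daffine])
    moreover have "z \<bullet> p' x X = 0"
      using range by auto
    then have "(u - (z \<bullet> u) *\<^sub>R z) \<bullet> p' x X = u \<bullet> p' x X"
      by (simp add: inner_diff_left)
    ultimately show ?thesis
      using X[of v] v by (simp add: inner_commute)
  qed

  obtain I :: "('k ^ 'm option) set" and b where b: "orthonormal_frame (fubini_study w) I b"
    using fubini_study_frame unfolding w_def z_def by blast
  obtain C a where a: "orthonormal_frame (g x) (I <+> C) a"
      and Inl: "\<And>i. p' x (a (Inl i)) = lift z (b i)"
      and Inr: "\<And>c. c \<in> C \<Longrightarrow> p' x (a (Inr c)) = rscale z c"
    using adapted_frame_exists[OF dim z range b[unfolded w_def]] unfolding g by blast
  have fin: "finite I" "finite C"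
    using a by (auto simp: orthonormal_frame_def)

  define g' where "g' = (\<lambda>d v u. p' x v \<bullet> p'' d u + p'' d v \<bullet> p' x u)"
  have g': "((\<lambda>y. g y v u) has_derivative (\<lambda>d. g' d v u)) (at x)" for v u
    unfolding g g'_def by (intro has_derivative_inner has_second_derivativeD(2)[OF p2])
  have "laplacian g f x = (\<Sum>i\<in>I <+> C. F'' (p' x (a i)) (p' x (a i)) + F' z (p'' (a i) (a i))
      - (g' (a i) (a i) X - g' X (a i) (a i) / 2))"
    unfolding X_def by (rule laplacian_orthonormal_frame[OF gU g' f2 a])
  \<comment> \<open>By symmetry of \<open>p''\<close> the Christoffel term of the induced metric is
    \<open>p'' (a i) (a i) \<bullet> p' x X\<close>, which \<open>FX\<close> identifies with the
    term to be cancelled.\<close>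
  also have "\<dots> = (\<Sum>i\<in>I <+> C. F'' (p' x (a i)) (p' x (a i)))"
  proof (rule sum.cong[OF refl])
    fix i
    show "F'' (p' x (a i)) (p' x (a i)) + F' z (p'' (a i) (a i))
        - (g' (a i) (a i) X - g' X (a i) (a i) / 2) = F'' (p' x (a i)) (p' x (a i))"
      using second_derivative_symmetric[OF p2, of X "a i"]
        inner_commute[of "p'' (a i) X" "p' x (a i)"]
      by (simp add: g'_def FX)
  qed
  also have "\<dots> = (\<Sum>i\<in>I. F'' (lift z (b i)) (lift z (b i))) + (\<Sum>c\<in>C. F'' (rscale z c) (rscale z c))"
    using fin by (simp add: sum.Plus Inl Inr)
  also have "(\<Sum>c\<in>C. F'' (rscale z c) (rscale z c)) = 0"
    by (simp add: F''_def z d2affine_rscale_self linear_0[OF lin\<phi>(1)] linear_0[OF lin\<phi>(2)])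
  \<comment> \<open>The part of \<open>F''\<close> that contains \<open>d2affine\<close> matches the
    Christoffel term of the chart once \<open>\<phi>'\<close> is written as a pairing with the
    gradient.\<close>
  also have "(\<Sum>i\<in>I. F'' (lift z (b i)) (lift z (b i))) + 0 = (\<Sum>i\<in>I. \<phi>'' (b i) (b i)
      - (fubini_study_deriv w (b i) (b i) (grad fubini_study \<phi> w)
         - fubini_study_deriv w (grad fubini_study \<phi> w) (b i) (b i) / 2))"
  proof -
    have "fubini_study w u (grad fubini_study \<phi> w) = \<phi>' w u" for u
      using grad_inner[of fubini_study w \<phi>, OF inner_form_fubini_study has_second_derivativeD(1)[OF \<phi>w]]
        inner_form_sym[OF inner_form_fubini_study] by metis
    then show ?thesis
      unfolding fubini_study_christoffel
      by (simp add: F''_def z d2affine_lift flip: w_def)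
  qed
  also have "\<dots> = laplacian fubini_study \<phi> w"
    by (rule laplacian_orthonormal_frame[OF _ fubini_study_has_derivative \<phi>w b, symmetric])
      (simp add: inner_form_fubini_study)
  finally show ?thesis
    by (simp add: g_def w_def z_def)
qed

text \<open>Real and imaginary parts are treated alike through a bounded linear functional; the
  complex product of gradients involves all four pairings of them, hence two functionals
  \<open>L\<close> and \<open>M\<close>.\<close>

lemma
  assumes \<phi>: "smooth_on UNIV (\<phi> \<circ> affine_param e)"
  shows claplacian_orbit: "claplacian (metric round_sphere (U, p)) (\<phi> \<circ> orbit \<circ> p) x =
      claplacian fubini_study (\<phi> \<circ> affine_param e) (affine_coords (p x))" (is ?lap)
    and cbilinear_cgrad_orbit: "smooth_on UNIV (\<psi> \<circ> affine_param e) \<Longrightarrow>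
      cbilinear (metric round_sphere (U, p)) x
        (cgrad (metric round_sphere (U, p)) (\<phi> \<circ> orbit \<circ> p) x)
        (cgrad (metric round_sphere (U, p)) (\<psi> \<circ> orbit \<circ> p) x) =
      cbilinear fubini_study (affine_coords (p x))
        (cgrad fubini_study (\<phi> \<circ> affine_param e) (affine_coords (p x)))
        (cgrad fubini_study (\<psi> \<circ> affine_param e) (affine_coords (p x)))" (is "_ \<Longrightarrow> ?grad")
proof -
  have "continuous_on U p" "open U"
    using p smooth_on_imp_continuous_on unfolding round_sphere_params_iff by blast+
  then have "open (U \<inter> p -` {z. z $ pole \<noteq> 0})"
    using continuous_open_preimage open_pole_ne_0 by blast
  then have eq: "\<forall>\<^sub>F y in nhds x. L ((\<phi> \<circ> orbit \<circ> p) y) = L ((\<phi> \<circ> affine_param e) (affine_coords (p y)))"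
    for L :: "complex \<Rightarrow> real" and \<phi>
    unfolding eventually_nhds
    using pole x norm_round_sphere_param[OF p]
    by (intro exI[of _ "U \<inter> p -` {z. z $ pole \<noteq> 0}"]) (auto simp: orbit_eq_affine_param)
  have second: "\<exists>\<phi>' \<phi>''. has_second_derivative (\<lambda>w. L ((\<phi> \<circ> affine_param e) w)) \<phi>' \<phi>'' (affine_coords (p x))"
    if "smooth_on UNIV (\<phi> \<circ> affine_param e)" "bounded_linear L" for \<phi> and L :: "complex \<Rightarrow> real"
    using has_second_derivative_bounded_linear[OF that(2)
        smooth_on_has_second_derivative[OF that(1) open_UNIV UNIV_I]] by blast
  note Re = bounded_linear_Re and Im = bounded_linear_Im
  have lap: "laplacian (metric round_sphere (U, p)) (\<lambda>y. L ((\<phi> \<circ> orbit \<circ> p) y)) x =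
      laplacian fubini_study (\<lambda>w. L ((\<phi> \<circ> affine_param e) w)) (affine_coords (p x))"
    if "bounded_linear L" for L
    using second[OF \<phi> that] by (elim exE) (rule laplacian_orbit[OF _ eq])
  show ?lap
    unfolding claplacian_def by (simp only: lap[OF Re] lap[OF Im])
  assume \<psi>: "smooth_on UNIV (\<psi> \<circ> affine_param e)"
  have grad: "metric round_sphere (U, p) x
        (grad (metric round_sphere (U, p)) (\<lambda>y. L ((\<phi> \<circ> orbit \<circ> p) y)) x)
        (grad (metric round_sphere (U, p)) (\<lambda>y. M ((\<psi> \<circ> orbit \<circ> p) y)) x) =
      fubini_study (affine_coords (p x))
        (grad fubini_study (\<lambda>w. L ((\<phi> \<circ> affine_param e) w)) (affine_coords (p x)))
        (grad fubini_study (\<lambda>w. M ((\<psi> \<circ> affine_param e) w)) (affine_coords (p x)))"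
    if "bounded_linear L" "bounded_linear M" for L M
    using second[OF \<phi> that(1)] second[OF \<psi> that(2)]
    by (elim exE) (rule grad_inner_grad_orbit[OF has_second_derivativeD(1) has_second_derivativeD(1) eq eq])
  show ?grad
    unfolding cbilinear_def cgrad_def fst_conv snd_conv
    by (simp only: grad[OF Re Re] grad[OF Re Im] grad[OF Im Re] grad[OF Im Im])
qed

end


section \<open>Smooth functions\<close>

lemma smooth_on_affine:
  "smooth_on {z. z $ pole \<noteq> 0}
    (affine_coords :: 'k::{real_normed_div_algebra, euclidean_space} ^ 'm option \<Rightarrow> _)"
  unfolding affine_coords_def
  by (intro smooth_on_bilinear[OF bounded_bilinear_rscale] open_pole_ne_0 smooth_on_inverse
      smooth_on_bounded_linear[OF bounded_linear_rest]
      smooth_on_bounded_linear[OF bounded_linear_vec_nth] smooth_on_id) simp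

lemma smooth_on_section_map:
  "smooth_on UNIV (section_map :: 'k::{real_normed_div_algebra, euclidean_space} ^ 'm \<Rightarrow> _)"
proof -
  have "linear (\<lambda>w :: 'k ^ 'm. join w 0)"
    by (rule linearI; rule vec_eqI) (simp_all add: rest_simps)
  then have L: "bounded_linear (\<lambda>w :: 'k ^ 'm. join w 0)"
    by (simp add: linear_conv_bounded_linear)
  have eq: "(\<lambda>w :: 'k ^ 'm. join w 1) = (\<lambda>w. join w 0 + join 0 1)"
    by (rule ext; rule vec_eqI) (simp_all add: rest_simps)
  have "smooth_on UNIV (\<lambda>w :: 'k ^ 'm. join w 1)"
    unfolding eq
    by (intro smooth_on_add smooth_on_const smooth_on_bounded_linear[OF L] smooth_on_id open_UNIV)
  then show ?thesis
    unfolding section_map_def by (intro smooth_on_normalize) (auto simp: join_ne_0)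
qed

text \<open>\<open>f \<circ> orbit\<close> is known to be smooth only in parametrizations of the
  sphere, so the section is followed by the smooth inverse \<open>r\<close> of one: locally
  \<open>f \<circ> affine_param e\<close> is
  \<open>(f \<circ> orbit \<circ> p) \<circ> (r \<circ> section_map)\<close>.\<close>

lemma smooth_on_affine_param:
  fixes f :: "('k::{real_normed_div_algebra, euclidean_space} ^ 'm option) set \<Rightarrow> complex"
  assumes dim: "DIM('e::euclidean_space) + 1 = DIM('k ^ 'm option)"
    and f: "smooth_fun (round_sphere :: ('k ^ 'm option, 'e) riemannian) (f \<circ> orbit)"
  shows "smooth_on UNIV (f \<circ> affine_param e)"
proof -
  \<comment> \<open>Central projection reaches only the open hemisphere around
    \<open>section_map w0\<close>; \<open>W w0\<close> is its trace in the chart, and these sets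
    cover because \<open>w\<close> lies in \<open>W w\<close>.\<close>
  define W where "W w0 = {w. 0 < section_map w \<bullet> section_map w0}" for w0 :: "'k ^ 'm"
  have "open (W w0)" for w0
    unfolding W_def using smooth_on_imp_continuous_on[OF smooth_on_section_map[where 'k = 'k]]
    by (intro open_Collect_less continuous_intros)
  moreover have "smooth_on (W w0) (f \<circ> affine_param e)" for w0
  proof -
    obtain p :: "'e \<Rightarrow> 'k ^ 'm option" and r where p: "(UNIV, p) \<in> params round_sphere"
      and r: "smooth_on {y. 0 < y \<bullet> section_map w0} r"
      and pr: "\<And>y. norm y = 1 \<Longrightarrow> 0 < y \<bullet> section_map w0 \<Longrightarrow> p (r y) = y"
      using central_projection_param[OF dim norm_section_map[of w0]] by blast
    have "smooth_on UNIV (f \<circ> orbit \<circ> p)"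
      using f p unfolding smooth_fun_def by blast
    moreover have "smooth_on (W w0) (\<lambda>w. r (section_map w))"
    proof (rule smooth_on_compose[OF \<open>open (W w0)\<close> _ _ _ r])
      show "open {y. 0 < y \<bullet> section_map w0}"
        by (intro open_Collect_less continuous_intros)
      show "smooth_on (W w0) section_map"
        using smooth_on_section_map by (rule smooth_on_subset) simp
    qed (auto simp: W_def)
    ultimately have "smooth_on (W w0) (\<lambda>w. (f \<circ> orbit \<circ> p) (r (section_map w)))"
      using smooth_on_compose[OF \<open>open (W w0)\<close> open_UNIV subset_UNIV] by blast
    moreover have "(f \<circ> orbit \<circ> p) (r (section_map w)) = (f \<circ> affine_param e) w" if "w \<in> W w0" for w
      using that pr[OF norm_section_map[of w]] by (simp add: W_def affine_param_eq)
    ultimately show ?thesis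
      by (subst (asm) smooth_on_cong[OF \<open>open (W w0)\<close>])
  qed
  ultimately have "smooth_on (\<Union>w0\<in>UNIV. W w0) (f \<circ> affine_param e)"
    by (intro smooth_on_Union)
  moreover have "w \<in> W w" for w
    using section_map_pole[of w] by (auto simp: W_def)
  then have "(\<Union>w0\<in>UNIV. W w0) = UNIV"
    by blast
  ultimately show ?thesis by simp
qed

end

section \<open>From single charts to the whole projective space\<close>

lemma affine_chart_at:
  fixes z :: "'k::{real_normed_div_algebra, euclidean_space} ^ 'm::finite option"
  assumes "norm z = 1"
  shows "\<exists>e. affine_chart e \<and> z $ affine_chart.pole e \<noteq> 0"
proof -
  have "z \<noteq> 0" using assms by auto
  then obtain i where "z $ i \<noteq> 0"
    by (auto simp: vec_eq_iff)
  then show ?thesis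
    using affine_chart_exists[of i] by blast
qed

lemma params_projective_space: "params (projective_space S) = {(UNIV, affine_param e) | e. affine_chart e}"
  by (simp add: projective_space_def affine_chart_def)

text \<open>Downwards, smoothness is carried by the section. Upwards,
  \<open>f \<circ> orbit \<circ> p\<close> factors through the affine chart on each open set
  \<open>V e\<close>, and these cover \<open>U\<close> since a unit vector has a nonzero
  coordinate.\<close>

lemma smooth_fun_projective_space_iff:
  fixes f :: "('k::{real_normed_div_algebra, euclidean_space} ^ 'm::finite option) set \<Rightarrow> complex"
  assumes dim: "DIM('e::euclidean_space) + 1 = DIM('k ^ 'm option)"
  defines "S \<equiv> round_sphere :: ('k ^ 'm option, 'e) riemannian"
  shows "smooth_fun (projective_space S) f \<longleftrightarrow> smooth_fun S (f \<circ> orbit)"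
proof
  assume "smooth_fun S (f \<circ> orbit)"
  then show "smooth_fun (projective_space S) f"
    using affine_chart.smooth_on_affine_param[OF _ dim, of _ f]
    by (auto simp: smooth_fun_def S_def params_projective_space)
next
  assume f: "smooth_fun (projective_space S) f"
  show "smooth_fun S (f \<circ> orbit)"
    unfolding smooth_fun_def
  proof clarify
    fix U p assume p: "(U, p) \<in> params S"
    have smooth_p: "smooth_on U p" and U: "open U"
      using p unfolding S_def round_sphere_params_iff by auto
    define V where "V e = U \<inter> p -` {z. z $ affine_chart.pole e \<noteq> 0}" for e :: "'m \<Rightarrow> 'm option"
    have V: "open (V e)" if "affine_chart e" for e
      unfolding V_def using smooth_on_imp_continuous_on[OF smooth_p] U affine_chart.open_pole_ne_0[OF that]
      by (intro continuous_open_preimage)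
    have "smooth_on (V e) (f \<circ> orbit \<circ> p)" if e: "affine_chart e" for e
    proof -
      interpret affine_chart e by fact
      have "smooth_on UNIV (f \<circ> affine_param e)"
        using f e unfolding smooth_fun_def params_projective_space by blast
      moreover have "smooth_on (V e) (\<lambda>y. affine_coords (p y))"
      proof (rule smooth_on_compose[OF V[OF e] open_pole_ne_0 _ _ smooth_on_affine])
        show "smooth_on (V e) p"
          using smooth_p by (rule smooth_on_subset) (simp add: V_def)
      qed (auto simp: V_def)
      ultimately have "smooth_on (V e) (\<lambda>y. (f \<circ> affine_param e) (affine_coords (p y)))"
        using smooth_on_compose[OF V[OF e] open_UNIV subset_UNIV] by blast
      moreover have "(f \<circ> affine_param e) (affine_coords (p y)) = (f \<circ> orbit \<circ> p) y" if "y \<in> V e" for y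
        using that norm_round_sphere_param[of U p y] p
        by (auto simp: V_def S_def orbit_eq_affine_param)
      ultimately show ?thesis
        by (subst (asm) smooth_on_cong[OF V[OF e]])
    qed
    with V have "smooth_on (\<Union>e\<in>{e. affine_chart e}. V e) (f \<circ> orbit \<circ> p)"
      by (intro smooth_on_Union) auto
    moreover have "(\<Union>e\<in>{e. affine_chart e}. V e) = U"
      using affine_chart_at[OF norm_round_sphere_param[of U p]] p by (auto simp: V_def S_def)
    ultimately show "smooth_on U (f \<circ> orbit \<circ> p)"
      by simp
  qed
qed

theorem eigenfamily_projective_space_iff:
  fixes \<F> :: "(('k::{real_normed_div_algebra, euclidean_space} ^ 'm::finite option) set \<Rightarrow> complex) set"
  assumes dim: "DIM('e::euclidean_space) + 1 = DIM('k ^ 'm option)"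
  defines "S \<equiv> round_sphere :: ('k ^ 'm option, 'e) riemannian"
  shows "eigenfamily l \<mu> (projective_space S) \<F> \<longleftrightarrow> eigenfamily l \<mu> S (pullback orbit \<F>)"
proof -
  have metric: "metric (projective_space S) (UNIV, affine_param e) = fubini_study"
    if "affine_chart e" for e
    using affine_chart.submersion_metric_eq_fubini_study[OF that dim]
    by (simp add: projective_space_def S_def fun_eq_iff)
  let ?P = "\<lambda>\<phi> \<psi> (e :: 'm \<Rightarrow> 'm option) (w :: 'k ^ 'm). claplacian fubini_study (\<phi> \<circ> affine_param e) w = l * \<phi> (affine_param e w) \<and>
      cbilinear fubini_study w (cgrad fubini_study (\<phi> \<circ> affine_param e) w)
        (cgrad fubini_study (\<psi> \<circ> affine_param e) w) = \<mu> * \<phi> (affine_param e w) * \<psi> (affine_param e w)"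
  let ?Q = "\<lambda>\<phi> \<psi> U p x. claplacian (metric S (U, p)) (\<phi> \<circ> orbit \<circ> p) x = l * \<phi> (orbit (p x)) \<and>
      cbilinear (metric S (U, p)) x (cgrad (metric S (U, p)) (\<phi> \<circ> orbit \<circ> p) x)
        (cgrad (metric S (U, p)) (\<psi> \<circ> orbit \<circ> p) x) = \<mu> * \<phi> (orbit (p x)) * \<psi> (orbit (p x))"
  have ball: "(\<forall>(V, q)\<in>params (projective_space S). R V q) \<longleftrightarrow>
      (\<forall>e. affine_chart e \<longrightarrow> R UNIV (affine_param e))" for R
    by (auto simp: params_projective_space)
  have lhs: "eigenfamily l \<mu> (projective_space S) \<F> \<longleftrightarrow>
      (\<forall>\<phi>\<in>\<F>. smooth_fun (projective_space S) \<phi>) \<and>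
      (\<forall>\<phi>\<in>\<F>. \<forall>\<psi>\<in>\<F>. \<forall>e. affine_chart e \<longrightarrow> (\<forall>w. ?P \<phi> \<psi> e w))"
    unfolding eigenfamily_def ball by (simp add: metric)
  have ball_pullback: "(\<forall>\<phi>\<in>pullback orbit \<F>. R \<phi>) \<longleftrightarrow> (\<forall>\<phi>\<in>\<F>. R (\<phi> \<circ> orbit))"
    for R :: "('k ^ 'm option \<Rightarrow> complex) \<Rightarrow> bool"
    by (auto simp: pullback_def)
  have ball_params: "(\<forall>(U, p)\<in>params S. R U p) \<longleftrightarrow> (\<forall>U p. (U, p) \<in> params S \<longrightarrow> R U p)" for R
    by auto
  have rhs: "eigenfamily l \<mu> S (pullback orbit \<F>) \<longleftrightarrow>
      (\<forall>\<phi>\<in>\<F>. smooth_fun S (\<phi> \<circ> orbit)) \<and>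
      (\<forall>\<phi>\<in>\<F>. \<forall>\<psi>\<in>\<F>. \<forall>U p. (U, p) \<in> params S \<longrightarrow> (\<forall>x\<in>U. ?Q \<phi> \<psi> U p x))"
    unfolding eigenfamily_def ball_pullback ball_params by simp
  \<comment> \<open>Both sides of the equations take equal values at \<open>x\<close> and at its
    image in the chart, so the equivalence is pointwise.\<close>
  have PQ: "?P \<phi> \<psi> e (affine_chart.affine_coords e (p x)) \<longleftrightarrow> ?Q \<phi> \<psi> U p x"
    if "affine_chart e" "(U, p) \<in> params S" "x \<in> U" "p x $ affine_chart.pole e \<noteq> 0"
      "smooth_fun (projective_space S) \<phi>" "smooth_fun (projective_space S) \<psi>"
    for \<phi> \<psi> e U p x
  proof -
    interpret affine_chart e by fact
    have smooth: "smooth_on UNIV (\<phi> \<circ> affine_param e)" "smooth_on UNIV (\<psi> \<circ> affine_param e)"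
      using that unfolding smooth_fun_def params_projective_space by blast+
    have "orbit (p x) = affine_param e (affine_coords (p x))"
      using that norm_round_sphere_param[of U p x] by (simp add: S_def orbit_eq_affine_param)
    then show ?thesis
      using claplacian_orbit[OF dim that(2)[unfolded S_def] that(3,4) smooth(1)]
        cbilinear_cgrad_orbit[OF dim that(2)[unfolded S_def] that(3,4) smooth]
      by (simp add: S_def)
  qed
  \<comment> \<open>Passing to all points takes a chart around each point of the sphere for one
    direction, and a parametrization through a point over each \<open>w\<close> for the
    other.\<close>
  have PQ_all: "(\<forall>e. affine_chart e \<longrightarrow> (\<forall>w. ?P \<phi> \<psi> e w)) \<longleftrightarrow>
      (\<forall>U p. (U, p) \<in> params S \<longrightarrow> (\<forall>x\<in>U. ?Q \<phi> \<psi> U p x))"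
    if smooth: "smooth_fun (projective_space S) \<phi>" "smooth_fun (projective_space S) \<psi>" for \<phi> \<psi>
  proof (intro iffI allI impI ballI)
    fix U p x assume P: "\<forall>e. affine_chart e \<longrightarrow> (\<forall>w. ?P \<phi> \<psi> e w)" and p: "(U, p) \<in> params S" "x \<in> U"
    obtain e where "affine_chart e" "p x $ affine_chart.pole e \<noteq> 0"
      using affine_chart_at[OF norm_round_sphere_param[of U p x]] p unfolding S_def by blast
    with P show "?Q \<phi> \<psi> U p x"
      using PQ[OF _ p _ smooth] by blast
  next
    fix e :: "'m \<Rightarrow> 'm option" and w :: "'k ^ 'm"
    assume Q: "\<forall>U p. (U, p) \<in> params S \<longrightarrow> (\<forall>x\<in>U. ?Q \<phi> \<psi> U p x)" and e: "affine_chart e"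
    interpret affine_chart e by fact
    obtain U :: "'e set" and p x where p: "(U, p) \<in> params S" "x \<in> U" "p x = section_map w"
      using round_sphere_param_exists[OF dim norm_section_map[of w]] unfolding S_def by blast
    have "p x $ pole \<noteq> 0" "affine_coords (p x) = w"
      using p section_map_pole[of w] by simp_all
    then show "?P \<phi> \<psi> e w"
      using PQ[OF e p(1,2) _ smooth] Q p(1,2) by blast
  qed
  show ?thesis
    unfolding lhs rhs
  \<comment> \<open>The congruence rule makes smoothness available where the equations are compared,
    since \<open>PQ_all\<close> requires it.\<close>
  proof (rule conj_cong)
    note smooth_iff = smooth_fun_projective_space_iff[OF dim, folded S_def]
    show "(\<forall>\<phi>\<in>\<F>. smooth_fun (projective_space S) \<phi>) \<longleftrightarrow> (\<forall>\<phi>\<in>\<F>. smooth_fun S (\<phi> \<circ> orbit))"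
      by (simp add: smooth_iff)
    assume "\<forall>\<phi>\<in>\<F>. smooth_fun S (\<phi> \<circ> orbit)"
    then have "smooth_fun (projective_space S) \<phi>" if "\<phi> \<in> \<F>" for \<phi>
      using that by (simp add: smooth_iff)
    then show "(\<forall>\<phi>\<in>\<F>. \<forall>\<psi>\<in>\<F>. \<forall>e. affine_chart e \<longrightarrow> (\<forall>w. ?P \<phi> \<psi> e w)) \<longleftrightarrow>
        (\<forall>\<phi>\<in>\<F>. \<forall>\<psi>\<in>\<F>. \<forall>U p. (U, p) \<in> params S \<longrightarrow> (\<forall>x\<in>U. ?Q \<phi> \<psi> U p x))"
      by (intro ball_cong refl PQ_all)
  qed
qed

theorem theorem2:
  fixes l \<mu> :: complex
  shows
    "(\<forall>\<F> :: ((real ^ 'm::finite option) set \<Rightarrow> complex) set.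
        eigenfamily l \<mu> RP \<F> \<longleftrightarrow> eigenfamily l \<mu> sphere_R (pullback orbit \<F>)) \<and>
     (\<forall>\<F> :: ((complex ^ 'm option) set \<Rightarrow> complex) set.
        eigenfamily l \<mu> CP \<F> \<longleftrightarrow> eigenfamily l \<mu> sphere_C (pullback orbit \<F>)) \<and>
     (\<forall>\<F> :: ((quat ^ 'm option) set \<Rightarrow> complex) set.
        eigenfamily l \<mu> HP \<F> \<longleftrightarrow> eigenfamily l \<mu> sphere_H (pullback orbit \<F>))"
  unfolding RP_def CP_def HP_def
  \<comment> \<open>What remains are the dimension counts \<open>m + 1\<close>,
    \<open>(2 m + 1) + 1 = 2 (m + 1)\<close> and \<open>(4 m + 3) + 1 = 4 (m + 1)\<close>.\<close>
  by (intro conjI allI eigenfamily_projective_space_iff) simp_all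

end
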